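(* Let $\mathcal{N}$ be a $C^2$ manifold, $h\ge1$, $\omega\in C^1\mathcal{F}^h(\mathcal{N})$ a (real-valued) differential $h$-form of class $C^1$, $U\subset\mathbb{R}^M$ open and $f:U\to\mathcal{N}$ a $C^1$ map. Then for every $\lambda\in C^1\mathcal{F}^{h-1}(U)$, $$U\cap\{d\lambda=f^*\omega\}^{(M+1)}\subset\{f^*d\omega=0\},$$ where $\{d\lambda=f^*\omega\}:=\{x\in U\mid (d\lambda)_x=(f^*\omega)_x\}$ and $\{f^*d\omega=0\}:=\{x\in U\mid (f^*d\omega)_x=0\}$.
   Context: $C^p\mathcal{F}^h(\cdot)$ denotes differential $h$-forms with $C^p$ coefficients. Superdensity: for $E\subset\mathbb{R}^M$ and $m\ge M$, $E^{(m)}$ is the set of points $x\in\mathbb{R}^M$ with $\mathcal{L}^M(B_r(x)\setminus E)=o(r^m)$ as $r\to0^+$, where $\mathcal{L}^M$ is Lebesgue measure and $B_r(x)$ the open ball. *)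

theory Defs
  imports "HOL-Analysis.Analysis" "HOL-Library.Landau_Symbols"
begin

definition C1_on :: "'a::real_normed_vector set \<Rightarrow> ('a \<Rightarrow> 'b::real_normed_vector) \<Rightarrow> bool" where
  "C1_on S g \<longleftrightarrow> (\<exists>g'. (\<forall>x\<in>S. (g has_derivative blinfun_apply (g' x)) (at x)) \<and> continuous_on S g')"

definition C2_on :: "'a::real_normed_vector set \<Rightarrow> ('a \<Rightarrow> 'b::real_normed_vector) \<Rightarrow> bool" where
  "C2_on S g \<longleftrightarrow> (\<exists>g'. (\<forall>x\<in>S. (g has_derivative blinfun_apply (g' x)) (at x)) \<and> C1_on S g')"

text \<open>A (real-valued) h-covector on a vector space V is represented as a function
  of a sequence of vectors (nat => V), depending only on the first h entries,
  linear in each of them and alternating.  A differential h-form on S is a map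
  x |-> (h-covector at x).\<close>

definition alt_form :: "nat \<Rightarrow> ((nat \<Rightarrow> 'v::real_vector) \<Rightarrow> real) \<Rightarrow> bool" where
  "alt_form h \<alpha> \<longleftrightarrow>
     (\<forall>v w. (\<forall>i<h. v i = w i) \<longrightarrow> \<alpha> v = \<alpha> w) \<and>
     (\<forall>i<h. \<forall>v. linear (\<lambda>u. \<alpha> (v(i := u)))) \<and>
     (\<forall>v i j. i < h \<and> j < h \<and> i \<noteq> j \<and> v i = v j \<longrightarrow> \<alpha> v = 0)"

definition C1_form :: "nat \<Rightarrow> 'v::real_normed_vector set \<Rightarrow> ('v \<Rightarrow> (nat \<Rightarrow> 'v) \<Rightarrow> real) \<Rightarrow> bool" where
  "C1_form h S \<omega> \<longleftrightarrow> (\<forall>x\<in>S. alt_form h (\<omega> x)) \<and> (\<forall>v. C1_on S (\<lambda>x. \<omega> x v))"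

definition skip :: "nat \<Rightarrow> (nat \<Rightarrow> 'v) \<Rightarrow> nat \<Rightarrow> 'v" where
  "skip i v = (\<lambda>k. if k < i then v k else v (Suc k))"

definition ext_d :: "nat \<Rightarrow> ('v::real_normed_vector \<Rightarrow> (nat \<Rightarrow> 'v) \<Rightarrow> real) \<Rightarrow> 'v \<Rightarrow> (nat \<Rightarrow> 'v) \<Rightarrow> real" where
  "ext_d h \<omega> x v = (\<Sum>i\<le>h. (-1) ^ i * frechet_derivative (\<lambda>y. \<omega> y (skip i v)) (at x) (v i))"

definition pullback :: "('u::real_normed_vector \<Rightarrow> 'v::real_normed_vector) \<Rightarrow> ('v \<Rightarrow> (nat \<Rightarrow> 'v) \<Rightarrow> real) \<Rightarrow> 'u \<Rightarrow> (nat \<Rightarrow> 'u) \<Rightarrow> real" where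
  "pullback g \<alpha> x v = \<alpha> (g x) (\<lambda>i. frechet_derivative g (at x) (v i))"

definition C2_atlas :: "'a topology \<Rightarrow> ('a set \<times> ('a \<Rightarrow> real^'n::finite)) set \<Rightarrow> bool" where
  "C2_atlas X A \<longleftrightarrow>
     (\<forall>(W,\<phi>)\<in>A. openin X W \<and> open (\<phi> ` W) \<and>
                  homeomorphic_map (subtopology X W) (top_of_set (\<phi> ` W)) \<phi>) \<and>
     (\<Union>(W,\<phi>)\<in>A. W) = topspace X \<and>
     (\<forall>(W,\<phi>)\<in>A. \<forall>(W',\<psi>)\<in>A. C2_on (\<phi> ` (W \<inter> W')) (\<psi> \<circ> inv_into W \<phi>))"

definition C2_manifold :: "'a topology \<Rightarrow> ('a set \<times> ('a \<Rightarrow> real^'n::finite)) set \<Rightarrow> bool" where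
  "C2_manifold X A \<longleftrightarrow> Hausdorff_space X \<and> second_countable X \<and> C2_atlas X A"

text \<open>A differential h-form on the manifold: a local representative on each chart
  image, compatible under the transition maps.\<close>
type_synonym ('a, 'n) mform = "'a set \<times> ('a \<Rightarrow> real^'n) \<Rightarrow> real^'n \<Rightarrow> (nat \<Rightarrow> real^'n) \<Rightarrow> real"

definition C1_mform :: "'a topology \<Rightarrow> ('a set \<times> ('a \<Rightarrow> real^'n::finite)) set \<Rightarrow> nat \<Rightarrow> ('a, 'n::finite) mform \<Rightarrow> bool" where
  "C1_mform X A h \<omega> \<longleftrightarrow>
     (\<forall>c\<in>A. C1_form h (snd c ` fst c) (\<omega> c)) \<and>
     (\<forall>(W,\<phi>)\<in>A. \<forall>(W',\<psi>)\<in>A. \<forall>y\<in>\<phi> ` (W \<inter> W'). \<forall>v.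
         \<omega> (W,\<phi>) y v = pullback (\<psi> \<circ> inv_into W \<phi>) (\<omega> (W',\<psi>)) y v)"

definition mext_d :: "nat \<Rightarrow> ('a, 'n::finite) mform \<Rightarrow> ('a, 'n::finite) mform" where
  "mext_d h \<omega> = (\<lambda>c. ext_d h (\<omega> c))"

definition C1_map_to :: "'m::euclidean_space set \<Rightarrow> 'a topology \<Rightarrow> ('a set \<times> ('a \<Rightarrow> real^'n::finite)) set \<Rightarrow> ('m \<Rightarrow> 'a) \<Rightarrow> bool" where
  "C1_map_to U X A f \<longleftrightarrow> continuous_map (top_of_set U) X f \<and>
     (\<forall>(W,\<phi>)\<in>A. C1_on (U \<inter> f -` W) (\<phi> \<circ> f))"

text \<open>Pullback of a manifold form by f, computed in any chart around f x
  (independent of the chart by compatibility).\<close>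
definition mpullback :: "('a set \<times> ('a \<Rightarrow> real^'n::finite)) set \<Rightarrow> ('m::euclidean_space \<Rightarrow> 'a) \<Rightarrow> ('a, 'n::finite) mform \<Rightarrow> 'm \<Rightarrow> (nat \<Rightarrow> 'm) \<Rightarrow> real" where
  "mpullback A f \<omega> x v =
     (let c = (SOME c. c \<in> A \<and> f x \<in> fst c) in pullback (snd c \<circ> f) (\<omega> c) x v)"

definition superdense :: "nat \<Rightarrow> 'm::euclidean_space set \<Rightarrow> 'm set" where
  "superdense m E = {x. (\<lambda>r. measure lebesgue (ball x r - E)) \<in> o[at_right 0](\<lambda>r. r ^ m)}"

end

theory Submission
  imports Defs
begin

text \<open>
  Fix a point \<open>x\<close> of superdensity and write \<open>g\<close> for \<open>f\<close> in a chart around \<open>f x\<close>. For vectors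
  \<open>v\<^sub>0, \<dots>, v\<^sub>h\<close> and test functions \<open>\<chi>\<close> supported in the ball of radius \<open>r\<close> around \<open>x\<close>, consider
  \<open>\<Sum>\<^sub>i (-1)\<^sup>i \<integral> (g\<^sup>* \<omega> - d\<lambda>) (v\<^sub>0, \<dots>, v\<^sub>i omitted, \<dots>, v\<^sub>h) \<partial>\<^sub>i \<chi>\<close>.
  The integrand vanishes on the superdense set and \<open>\<partial>\<chi> = O(1/r)\<close> when \<open>\<chi>\<close> is normalised to height one,
  so the sum is \<open>o(r\<^sup>M)\<close>. On the other hand \<open>d\<lambda>\<close> and the pullback of the constant form \<open>\<omega>\<close> frozen at
  \<open>g x\<close> are weakly closed and contribute nothing, while the first-order increment of \<open>\<omega> \<circ> g\<close> at \<open>x\<close>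
  contributes \<open>- (g\<^sup>* d\<omega>)\<^sub>x (v\<^sub>0, \<dots>, v\<^sub>h) \<integral> \<chi> + o(r\<^sup>M)\<close>, where \<open>\<integral> \<chi>\<close> is of order \<open>r\<^sup>M\<close>.
\<close>

section \<open>Alternating forms\<close>

lemma skip_skip:
  assumes "j < i"
  shows "skip j (skip i v) = skip (i - 1) (skip j v)"
  using assms by (auto simp: skip_def fun_eq_iff)

lemma skip_comp: "skip i (\<lambda>k. f (v k)) = (\<lambda>k. f (skip i v k))"
  by (auto simp: skip_def)

text \<open>The index combinatorics of applying d twice: \<open>j\<close> is a position in the
  sequence from which entry \<open>i\<close> has been dropped, so for \<open>j < i\<close> the pairs
  \<open>(i, j)\<close> and \<open>(j, i - 1)\<close> name the same two omissions. Their index sums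
  differ by one, so the signs are opposite.\<close>

lemma double_skip_sum_eq_0:
  fixes F :: "nat \<Rightarrow> nat \<Rightarrow> real"
  assumes sym: "\<And>i j. j < i \<Longrightarrow> i \<le> h \<Longrightarrow> F i j = F j (i - 1)"
  shows "(\<Sum>i\<le>h. \<Sum>j<h. (-1) ^ (i + j) * F i j) = 0"
proof -
  let ?f = "\<lambda>(i, j). (-1) ^ (i + j) * F i j"
  let ?L = "{(i, j). i \<le> h \<and> j < i}" and ?G = "{(i, j). i \<le> j \<and> j < h}"
  have fin: "finite ?L" "finite ?G"
    by (rule finite_subset[of _ "{..h} \<times> {..h}"]; force)+
  have "(\<Sum>i\<le>h. \<Sum>j<h. (-1) ^ (i + j) * F i j) = sum ?f ({..h} \<times> {..<h})"
    by (simp add: sum.cartesian_product)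
  also have "{..h} \<times> {..<h} = ?L \<union> ?G"
    by auto
  also have "sum ?f (?L \<union> ?G) = sum ?f ?L + sum ?f ?G"
    using fin by (intro sum.union_disjoint) auto
  also have "sum ?f ?L = sum (\<lambda>p. - ?f p) ?G"
  proof (rule sum.reindex_bij_witness[of _ "\<lambda>(i, j). (Suc j, i)" "\<lambda>(i, j). (j, i - 1)"])
    fix p assume "p \<in> ?L"
    then obtain i j where p: "p = (Suc i, j)" "j \<le> i" "Suc i \<le> h"
      by (cases p; cases "fst p") auto
    show "- ?f (case p of (i, j) \<Rightarrow> (j, i - 1)) = ?f p"
      using p sym[of j "Suc i"] by (simp add: add.commute)
  qed auto
  finally show ?thesis
    by (simp add: sum_negf)
qed

lemma alt_form_cong: "alt_form h \<alpha> \<Longrightarrow> (\<And>i. i < h \<Longrightarrow> v i = w i) \<Longrightarrow> \<alpha> v = \<alpha> w"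
  unfolding alt_form_def by blast

lemma alt_form_linear: "alt_form h \<alpha> \<Longrightarrow> i < h \<Longrightarrow> linear (\<lambda>u. \<alpha> (v(i := u)))"
  unfolding alt_form_def by blast

lemma alt_form_eq_0: "alt_form h \<alpha> \<Longrightarrow> i < h \<Longrightarrow> j < h \<Longrightarrow> i \<noteq> j \<Longrightarrow> v i = v j \<Longrightarrow> \<alpha> v = 0"
  unfolding alt_form_def by blast

text \<open>Polarisation: put \<open>a + b\<close> into both slots, expand, and drop the diagonal
  terms.\<close>

lemma alt_form_swap:
  assumes \<alpha>: "alt_form h \<alpha>" and ij: "i < h" "j < h" "i \<noteq> j"
  shows "\<alpha> (v(i := a, j := b)) = - \<alpha> (v(i := b, j := a))"
proof -
  have add_j: "\<alpha> (w(j := a + b)) = \<alpha> (w(j := a)) + \<alpha> (w(j := b))" for w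
    using alt_form_linear[OF \<alpha> ij(2), of w] by (rule linear_add)
  have add_i: "\<alpha> (v(i := a + b, j := c)) = \<alpha> (v(i := a, j := c)) + \<alpha> (v(i := b, j := c))" for c
    using linear_add[OF alt_form_linear[OF \<alpha> ij(1), of "v(j := c)"], of a b] ij(3)
    by (simp add: fun_upd_twist)
  have diag: "\<alpha> (v(i := c, j := c)) = 0" for c
    using ij by (intro alt_form_eq_0[OF \<alpha> ij]) auto
  have "0 = \<alpha> (v(i := a + b, j := a + b))"
    by (simp add: diag)
  also have "\<dots> = \<alpha> (v(i := a, j := b)) + \<alpha> (v(i := b, j := a))"
    by (simp add: add_j add_i diag)
  finally show ?thesis
    by simp
qed

text \<open>Adjacent transpositions, \<open>k\<close> in number and each costing a sign, bring
  \<open>s\<close> to the front. The other arguments then appear as \<open>skip k u\<close>, the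
  shape in which \<open>double_skip_sum_eq_0\<close> cancels terms.\<close>

lemma alt_form_move_front:
  assumes \<alpha>: "alt_form h \<alpha>" and "k < h"
  shows "\<alpha> (u(k := s)) = (-1) ^ k * \<alpha> (case_nat s (skip k u))"
  using \<open>k < h\<close>
proof (induction k arbitrary: u)
  case 0
  have "u(0 := s) = case_nat s (skip 0 u)"
    by (auto simp: skip_def fun_eq_iff split: nat.split)
  then show ?case by simp
next
  case (Suc k)
  have "\<alpha> (u(Suc k := s)) = \<alpha> (u(k := u k, Suc k := s))"
    by simp
  also have "\<dots> = - \<alpha> (u(k := s, Suc k := u k))"
    using Suc.prems by (intro alt_form_swap[OF \<alpha>]) auto
  also have "u(k := s, Suc k := u k) = (u(Suc k := u k))(k := s)"
    by (simp add: fun_upd_twist)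
  also have "- \<alpha> \<dots> = - ((-1) ^ k * \<alpha> (case_nat s (skip k (u(Suc k := u k)))))"
    by (subst Suc.IH) (use Suc.prems in auto)
  also have "skip k (u(Suc k := u k)) = skip (Suc k) u"
    by (auto simp: skip_def fun_eq_iff less_Suc_eq)
  finally show ?case by simp
qed

text \<open>Expanding every slot in the orthonormal basis leaves the vectors only in products of
  coordinates, so limits, bounds and derivatives of forms reduce to finite sums of real
  functions.\<close>

lemma alt_form_expansion:
  fixes \<alpha> :: "(nat \<Rightarrow> 'v::euclidean_space) \<Rightarrow> real"
  assumes \<alpha>: "alt_form h \<alpha>"
  shows "\<alpha> v = (\<Sum>I\<in>PiE {..<h} (\<lambda>_. Basis). (\<Prod>k<h. v k \<bullet> I k) * \<alpha> I)"
proof -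
  \<comment> \<open>Induction on the number \<open>m\<close> of slots already expanded; the slots
    from \<open>m\<close> on still hold the original vectors.\<close>
  have "\<alpha> v = (\<Sum>I\<in>PiE {..<m} (\<lambda>_. Basis). (\<Prod>k<m. v k \<bullet> I k) * \<alpha> (\<lambda>k. if k < m then I k else v k))"
    if "m \<le> h" for m
    using that
  proof (induction m)
    case 0
    then show ?case by simp
  next
    case (Suc m)
    let ?w = "\<lambda>I k. if k < m then I k else v k"
    have slot: "\<alpha> (?w I) = (\<Sum>b\<in>Basis. (v m \<bullet> b) * \<alpha> ((?w I)(m := b)))" for I
    proof -
      have "(?w I)(m := v m) = ?w I"
        by auto
      then have "\<alpha> (?w I) = \<alpha> ((?w I)(m := (\<Sum>b\<in>Basis. (v m \<bullet> b) *\<^sub>R b)))"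
        by (simp add: euclidean_representation)
      also have "\<dots> = (\<Sum>b\<in>Basis. (v m \<bullet> b) * \<alpha> ((?w I)(m := b)))"
        using Suc.prems
        by (subst linear_sum[OF alt_form_linear[OF \<alpha>]], simp,
            subst linear_cmul[OF alt_form_linear[OF \<alpha>]]) auto
      finally show ?thesis .
    qed
    have upd: "(?w I)(m := b) = (\<lambda>k. if k < Suc m then (I(m := b)) k else v k)" for I b
      by (auto simp: fun_eq_iff less_Suc_eq)
    let ?g = "\<lambda>I. (\<Prod>k<Suc m. v k \<bullet> I k) * \<alpha> (\<lambda>k. if k < Suc m then I k else v k)"
    have "\<alpha> v = (\<Sum>I\<in>PiE {..<m} (\<lambda>_. Basis). (\<Prod>k<m. v k \<bullet> I k) * \<alpha> (?w I))"
      using Suc by simp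
    also have "\<dots> = (\<Sum>I\<in>PiE {..<m} (\<lambda>_. Basis). \<Sum>b\<in>Basis. ?g (I(m := b)))"
      by (subst slot) (simp add: upd sum_distrib_left mult.assoc)
    also have "\<dots> = sum (?g \<circ> (\<lambda>(b, I). I(m := b))) (Basis \<times> PiE {..<m} (\<lambda>_. Basis))"
    proof -
      have "(?g \<circ> (\<lambda>(b, I). I(m := b))) = (\<lambda>(b, I). ?g (I(m := b)))"
        by (rule ext) (simp only: o_apply split_paired_all prod.case)
      then show ?thesis
        by (subst sum.swap) (simp only: sum.cartesian_product)
    qed
    also have "\<dots> = sum ?g (PiE (insert m {..<m}) (\<lambda>_. Basis))"
      by (subst PiE_insert_eq, subst sum.reindex) (auto intro!: inj_combinator)
    also have "insert m {..<m} = {..<Suc m}"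
      by auto
    finally show ?case .
  qed
  from this[of h] have "\<alpha> v = (\<Sum>I\<in>PiE {..<h} (\<lambda>_. Basis). (\<Prod>k<h. v k \<bullet> I k) * \<alpha> (\<lambda>k. if k < h then I k else v k))"
    by simp
  also have "\<dots> = (\<Sum>I\<in>PiE {..<h} (\<lambda>_. Basis). (\<Prod>k<h. v k \<bullet> I k) * \<alpha> I)"
    by (intro sum.cong arg_cong2[where f="(*)"] refl alt_form_cong[OF \<alpha>]) auto
  finally show ?thesis .
qed

lemma tendsto_alt_form:
  fixes \<alpha> :: "(nat \<Rightarrow> 'v::euclidean_space) \<Rightarrow> real"
  assumes \<alpha>: "alt_form h \<alpha>" and w: "\<And>k. k < h \<Longrightarrow> ((\<lambda>t. w t k) \<longlongrightarrow> l k) F"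
  shows "((\<lambda>t. \<alpha> (w t)) \<longlongrightarrow> \<alpha> l) F"
  unfolding alt_form_expansion[OF \<alpha>, of l] alt_form_expansion[OF \<alpha>, of "w _"]
  by (intro tendsto_intros w) auto

lemma continuous_on_alt_form:
  fixes \<alpha> :: "(nat \<Rightarrow> 'v::euclidean_space) \<Rightarrow> real"
  assumes "alt_form h \<alpha>" and "\<And>k. k < h \<Longrightarrow> continuous_on S (\<lambda>t. w t k)"
  shows "continuous_on S (\<lambda>t. \<alpha> (w t))"
  using assms unfolding continuous_on_def by (blast intro: tendsto_alt_form)

lemma alt_form_bound:
  fixes \<alpha> :: "(nat \<Rightarrow> 'v::euclidean_space) \<Rightarrow> real"
  assumes \<alpha>: "alt_form h \<alpha>" and w: "\<And>k. k < h \<Longrightarrow> norm (w k) \<le> C k"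
  shows "\<bar>\<alpha> w\<bar> \<le> (\<Sum>I\<in>PiE {..<h} (\<lambda>_. Basis). (\<Prod>k<h. C k) * \<bar>\<alpha> I\<bar>)"
proof -
  have "\<bar>\<alpha> w\<bar> \<le> (\<Sum>I\<in>PiE {..<h} (\<lambda>_. Basis). \<bar>(\<Prod>k<h. w k \<bullet> I k) * \<alpha> I\<bar>)"
    unfolding alt_form_expansion[OF \<alpha>, of w] by (rule sum_abs)
  also have "\<dots> \<le> (\<Sum>I\<in>PiE {..<h} (\<lambda>_. Basis). (\<Prod>k<h. C k) * \<bar>\<alpha> I\<bar>)"
  proof (intro sum_mono)
    fix I :: "nat \<Rightarrow> 'v"
    assume I: "I \<in> PiE {..<h} (\<lambda>_. Basis)"
    have "\<bar>\<Prod>k<h. w k \<bullet> I k\<bar> \<le> (\<Prod>k<h. C k)"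
      unfolding abs_prod
    proof (intro prod_mono conjI abs_ge_zero)
      fix k assume "k \<in> {..<h}"
      then have "I k \<in> Basis" "k < h" using I by auto
      then show "\<bar>w k \<bullet> I k\<bar> \<le> C k"
        using Basis_le_norm[of "I k" "w k"] w[of k] by simp
    qed
    then show "\<bar>(\<Prod>k<h. w k \<bullet> I k) * \<alpha> I\<bar> \<le> (\<Prod>k<h. C k) * \<bar>\<alpha> I\<bar>"
      by (simp add: abs_mult mult_right_mono)
  qed
  finally show ?thesis .
qed

text \<open>Leibniz rule for the coordinate products. For fixed \<open>k\<close>, the sum over basis
  tuples is again an expansion, namely of the form with its \<open>k\<close>-th argument
  differentiated.\<close>

lemma alt_form_has_vector_derivative:
  fixes \<alpha> :: "(nat \<Rightarrow> 'v::euclidean_space) \<Rightarrow> real"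
  assumes \<alpha>: "alt_form h \<alpha>"
    and w: "\<And>k. k < h \<Longrightarrow> ((\<lambda>t. w t k) has_vector_derivative w' k) (at a)"
  shows "((\<lambda>t. \<alpha> (w t)) has_vector_derivative (\<Sum>k<h. \<alpha> ((w a)(k := w' k)))) (at a)"
proof -
  have comp: "((\<lambda>t. w t k \<bullet> I k) has_field_derivative w' k \<bullet> I k) (at a)" if "k \<in> {..<h}" for k I
    using bounded_linear.has_vector_derivative[OF bounded_linear_inner_left w, of k "I k"] that
    by (simp add: has_real_derivative_iff_has_vector_derivative)
  have prod: "((\<lambda>t. \<Prod>k<h. w t k \<bullet> I k) has_field_derivative
      (\<Sum>k<h. w' k \<bullet> I k * (\<Prod>l\<in>{..<h} - {k}. w a l \<bullet> I l))) (at a)" for I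
    by (rule has_field_derivative_prod) (rule comp)
  have "((\<lambda>t. \<alpha> (w t)) has_field_derivative
      (\<Sum>I\<in>PiE {..<h} (\<lambda>_. Basis). (\<Sum>k<h. w' k \<bullet> I k * (\<Prod>l\<in>{..<h} - {k}. w a l \<bullet> I l)) * \<alpha> I)) (at a)"
    unfolding alt_form_expansion[OF \<alpha>, of "w _"]
    by (intro DERIV_sum DERIV_cmult_right prod)
  moreover have "(\<Sum>I\<in>PiE {..<h} (\<lambda>_. Basis). (\<Sum>k<h. w' k \<bullet> I k * (\<Prod>l\<in>{..<h} - {k}. w a l \<bullet> I l)) * \<alpha> I)
      = (\<Sum>k<h. \<alpha> ((w a)(k := w' k)))"
  proof -
    have "(\<Prod>l<h. ((w a)(k := w' k)) l \<bullet> I l) = w' k \<bullet> I k * (\<Prod>l\<in>{..<h} - {k}. w a l \<bullet> I l)"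
      if "k < h" for k I
      using that by (subst prod.remove[of _ k]) (auto intro!: prod.cong)
    then have "(\<Sum>k<h. \<alpha> ((w a)(k := w' k))) = (\<Sum>k<h. \<Sum>I\<in>PiE {..<h} (\<lambda>_. Basis).
        w' k \<bullet> I k * (\<Prod>l\<in>{..<h} - {k}. w a l \<bullet> I l) * \<alpha> I)"
      by (subst alt_form_expansion[OF \<alpha>]) simp
    also have "\<dots> = (\<Sum>I\<in>PiE {..<h} (\<lambda>_. Basis). \<Sum>k<h.
        w' k \<bullet> I k * (\<Prod>l\<in>{..<h} - {k}. w a l \<bullet> I l) * \<alpha> I)"
      by (rule sum.swap)
    finally show ?thesis
      by (simp add: sum_distrib_right)
  qed
  ultimately show ?thesis
    by (simp add: has_real_derivative_iff_has_vector_derivative)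
qed

text \<open>With \<open>w\<close> in the role of a first derivative and \<open>S\<close> in that of
  a second derivative, this is closedness of the pullback of a constant form. Once the
  \<open>S\<close> argument is moved to the front, the symmetry of \<open>S\<close> makes the double
  sum cancel.\<close>

lemma alt_form_symmetric_sum_eq_0:
  assumes \<alpha>: "alt_form h \<alpha>" and sym: "\<And>i j. S (v i) (v j) = S (v j) (v i)"
  shows "(\<Sum>i\<le>h. (-1) ^ i * (\<Sum>k<h. \<alpha> ((\<lambda>l. w (skip i v l))(k := S (v i) (skip i v k))))) = 0"
proof -
  define F where "F i j = \<alpha> (case_nat (S (v i) (skip i v j)) (\<lambda>l. w (skip j (skip i v) l)))" for i j
  have "(-1) ^ i * \<alpha> ((\<lambda>l. w (skip i v l))(k := S (v i) (skip i v k))) = (-1) ^ (i + k) * F i k"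
    if "k < h" for i k
    using alt_form_move_front[OF \<alpha> that, of "\<lambda>l. w (skip i v l)"]
    by (simp add: F_def skip_comp power_add)
  then have "(\<Sum>i\<le>h. (-1) ^ i * (\<Sum>k<h. \<alpha> ((\<lambda>l. w (skip i v l))(k := S (v i) (skip i v k)))))
      = (\<Sum>i\<le>h. \<Sum>k<h. (-1) ^ (i + k) * F i k)"
    by (simp add: sum_distrib_left)
  also have "\<dots> = 0"
  proof (rule double_skip_sum_eq_0)
    fix i j :: nat assume "j < i"
    then have "skip i v j = v j" "skip j v (i - 1) = v i"
      by (auto simp: skip_def)
    then show "F i j = F j (i - 1)"
      unfolding F_def by (simp add: skip_skip[OF \<open>j < i\<close>] sym)
  qed
  finally show ?thesis .
qed

section \<open>Directional derivatives and integration by parts\<close>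

text \<open>Differentiability along a single line is what integration by parts uses, and it turns
  differentiation under the integral into a problem with one real parameter.\<close>

definition has_dir_deriv :: "('a::real_normed_vector \<Rightarrow> 'b::real_normed_vector) \<Rightarrow> 'a \<Rightarrow> 'b \<Rightarrow> 'a \<Rightarrow> bool" where
  "has_dir_deriv F u d y \<longleftrightarrow> ((\<lambda>t. F (y + t *\<^sub>R u)) has_vector_derivative d) (at 0)"

lemma has_derivative_imp_has_dir_deriv:
  assumes "(F has_derivative F') (at y)"
  shows "has_dir_deriv F u (F' u) y"
proof -
  have "((\<lambda>t. y + t *\<^sub>R u) has_vector_derivative u) (at 0)"
    by (auto intro!: derivative_eq_intros)
  then show ?thesis
    unfolding has_dir_deriv_def
    using vector_derivative_diff_chain_within[of "\<lambda>t. y + t *\<^sub>R u" u 0 UNIV F F']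
      has_derivative_at_withinI[OF assms] by (simp add: o_def)
qed

lemma has_dir_deriv_unique: "has_dir_deriv F u d y \<Longrightarrow> has_dir_deriv F u d' y \<Longrightarrow> d = d'"
  unfolding has_dir_deriv_def by (rule vector_derivative_unique_at)

lemma has_dir_deriv_along_line:
  assumes "has_dir_deriv F u d (y + t *\<^sub>R u)"
  shows "((\<lambda>s. F (y + s *\<^sub>R u)) has_vector_derivative d) (at t)"
proof -
  have "((\<lambda>s. s - t) has_vector_derivative 1) (at t)"
    by (auto intro!: derivative_eq_intros)
  moreover have "((\<lambda>s. F (y + t *\<^sub>R u + s *\<^sub>R u)) has_vector_derivative d) (at (t - t))"
    using assms by (simp add: has_dir_deriv_def)
  ultimately have "((\<lambda>s. F (y + t *\<^sub>R u + s *\<^sub>R u)) \<circ> (\<lambda>s. s - t) has_vector_derivative 1 *\<^sub>R d) (at t)"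
    by (rule vector_diff_chain_at)
  then show ?thesis
    by (simp add: o_def algebra_simps)
qed

lemma has_dir_deriv_locally_zero:
  assumes "open S" "y \<in> S" "\<And>z. z \<in> S \<Longrightarrow> F z = 0"
  shows "has_dir_deriv F u 0 y"
proof -
  have "((\<lambda>z. 0) has_derivative (\<lambda>_. 0)) (at y)"
    by simp
  then have "(F has_derivative (\<lambda>_. 0)) (at y)"
    by (rule has_derivative_transform_within_open[OF _ assms(1,2)]) (simp add: assms(3))
  from has_derivative_imp_has_dir_deriv[OF this] show ?thesis .
qed

section \<open>Integrals of compactly supported functions\<close>

lemma has_integral_UNIV_cbox_support:
  fixes f :: "'a::euclidean_space \<Rightarrow> 'b::banach"
  assumes "continuous_on (cbox a b) f" "\<And>y. y \<notin> cbox a b \<Longrightarrow> f y = 0"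
  shows "(f has_integral integral (cbox a b) f) UNIV"
  using assms by (intro has_integral_on_superset[OF integrable_integral]) (auto intro: integrable_continuous)

lemma integral_UNIV_cbox_support:
  fixes f :: "'a::euclidean_space \<Rightarrow> 'b::banach"
  assumes "continuous_on (cbox a b) f" "\<And>y. y \<notin> cbox a b \<Longrightarrow> f y = 0"
  shows "integral UNIV f = integral (cbox a b) f"
  using has_integral_UNIV_cbox_support[OF assms] by (rule integral_unique)

lemma integral_UNIV_translation:
  fixes f :: "'a::euclidean_space \<Rightarrow> 'b::banach"
  assumes "continuous_on (cbox a b) f" "\<And>y. y \<notin> cbox a b \<Longrightarrow> f y = 0"
  shows "integral UNIV (\<lambda>y. f (y + c)) = integral UNIV f"
proof -
  have "((\<lambda>y. f (y + c)) has_integral integral (cbox a b) f) (cbox (a - c) (b - c))"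
    by (intro has_integral_shift_cbox integrable_integral integrable_continuous assms)
  then have "((\<lambda>y. f (y + c)) has_integral integral (cbox a b) f) UNIV"
  proof (rule has_integral_on_superset)
    fix y assume "y \<notin> cbox (a - c) (b - c)"
    then have "y + c \<notin> cbox a b"
      by (auto simp: mem_box algebra_simps)
    then show "f (y + c) = 0" by (rule assms)
  qed auto
  then show ?thesis
    by (simp add: integral_unique integral_UNIV_cbox_support[OF assms])
qed

text \<open>By translation invariance \<open>t \<mapsto> \<integral> \<phi> (y + t u) dy\<close> is constant, and its derivative at
  \<open>0\<close> is the integral in question.\<close>
lemma integral_dir_deriv_eq_0:
  fixes \<phi> :: "'a::euclidean_space \<Rightarrow> 'b::euclidean_space"
  assumes \<phi>: "continuous_on UNIV \<phi>" and d: "continuous_on UNIV d"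
    and deriv: "\<And>y. has_dir_deriv \<phi> u (d y) y"
    and supp: "\<And>y. y \<notin> cbox a b \<Longrightarrow> \<phi> y = 0"
    and supp': "\<And>y. y \<notin> cbox a b \<Longrightarrow> d y = 0"
  shows "integral (cbox a b) d = 0"
proof -
  obtain C where C: "\<And>y. y \<in> cbox a b \<Longrightarrow> norm y \<le> C"
    using bounded_cbox[of a b] unfolding bounded_iff by blast
  \<comment> \<open>The larger box contains the supports of all translates with
    \<open>\<bar>t\<bar> < 1\<close>, so integrating over it amounts to integrating over the whole
    space.\<close>
  obtain c where c: "cball (0::'a) (C + norm u) \<subseteq> cbox (- c) c"
    using bounded_subset_cbox_symmetric[OF bounded_cball] by blast
  have out: "y + t *\<^sub>R u \<notin> cbox a b" if "y \<notin> cbox (- c) c" "\<bar>t\<bar> < 1" for y t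
  proof
    assume "y + t *\<^sub>R u \<in> cbox a b"
    then have "norm (y + t *\<^sub>R u) \<le> C" by (rule C)
    moreover have "norm (t *\<^sub>R u) \<le> norm u"
      using that(2) by (simp add: mult_left_le_one_le)
    moreover have "norm y \<le> norm (y + t *\<^sub>R u) + norm (t *\<^sub>R u)"
      by (metis add_diff_cancel_right' norm_triangle_ineq4)
    ultimately have "y \<in> cball 0 (C + norm u)"
      by simp
    with c that show False by auto
  qed
  let ?U = "{-1<..<1::real}" and ?B = "cbox (- c) c"
  have cont: "continuous_on S (\<lambda>y. \<phi> (y + t *\<^sub>R u))" for S t
    by (rule continuous_on_compose2[OF \<phi>]) (auto intro!: continuous_intros)
  have "((\<lambda>t. integral ?B (\<lambda>y. \<phi> (y + t *\<^sub>R u))) has_vector_derivative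
      integral ?B (\<lambda>y. d (y + 0 *\<^sub>R u))) (at 0 within ?U)"
  proof (rule leibniz_rule_vector_derivative)
    show "((\<lambda>t. \<phi> (y + t *\<^sub>R u)) has_vector_derivative d (y + t *\<^sub>R u)) (at t within ?U)" for t y
      using has_dir_deriv_along_line[OF deriv] by (rule has_vector_derivative_at_within)
    show "(\<lambda>y. \<phi> (y + t *\<^sub>R u)) integrable_on ?B" for t
      by (rule integrable_continuous[OF cont])
    show "continuous_on (?U \<times> ?B) (\<lambda>(t, y). d (y + t *\<^sub>R u))"
      unfolding split_beta by (rule continuous_on_compose2[OF d]) (auto intro!: continuous_intros)
  qed auto
  then have "((\<lambda>t. integral ?B (\<lambda>y. \<phi> (y + t *\<^sub>R u))) has_vector_derivative integral ?B d) (at 0)"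
    by (simp add: at_within_open[of _ "?U"])
  moreover have "((\<lambda>t. integral ?B (\<lambda>y. \<phi> (y + t *\<^sub>R u))) has_vector_derivative 0) (at 0)"
  proof (rule has_vector_derivative_transform_within_open[of "\<lambda>_. integral UNIV \<phi>" _ _ "?U"])
    fix t assume "t \<in> ?U"
    have "integral ?B (\<lambda>y. \<phi> (y + t *\<^sub>R u)) = integral UNIV (\<lambda>y. \<phi> (y + t *\<^sub>R u))"
      using \<open>t \<in> ?U\<close>
      by (intro integral_UNIV_cbox_support[OF cont, symmetric] supp out) auto
    also have "\<dots> = integral UNIV \<phi>"
      by (intro integral_UNIV_translation[of a b] supp continuous_on_subset[OF \<phi>]) auto
    finally show "integral UNIV \<phi> = integral ?B (\<lambda>y. \<phi> (y + t *\<^sub>R u))" ..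
  qed auto
  ultimately have "integral ?B d = 0"
    by (rule vector_derivative_unique_at)
  moreover have "integral ?B d = integral UNIV d"
    using out[of _ 0]
    by (intro integral_UNIV_cbox_support[symmetric] supp' continuous_on_subset[OF d]) auto
  moreover have "integral UNIV d = integral (cbox a b) d"
    by (intro integral_UNIV_cbox_support supp' continuous_on_subset[OF d]) auto
  ultimately show ?thesis by simp
qed

lemma has_dir_deriv_eq_0_outside:
  assumes "closed K" "\<And>y. y \<notin> K \<Longrightarrow> \<psi> y = 0" "has_dir_deriv \<psi> u d y" "y \<notin> K"
  shows "d = 0"
  using assms by (intro has_dir_deriv_unique[OF assms(3)] has_dir_deriv_locally_zero[of "- K"]) auto

text \<open>Extension by zero: \<open>F\<close> is controlled only on \<open>U\<close>, but the open
  sets \<open>U\<close> and \<open>- K\<close> cover the space and the product vanishes on the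
  second.\<close>

lemma continuous_on_UNIV_scaleR_support:
  fixes F :: "'a::topological_space \<Rightarrow> 'b::real_normed_vector"
  assumes "open U" "closed K" "K \<subseteq> U" "continuous_on U F" "continuous_on UNIV \<psi>"
    "\<And>y. y \<notin> K \<Longrightarrow> \<psi> y = 0"
  shows "continuous_on UNIV (\<lambda>y. \<psi> y *\<^sub>R F y)"
proof -
  have "continuous_on (U \<union> - K) (\<lambda>y. \<psi> y *\<^sub>R F y)"
  proof (rule continuous_on_open_Un)
    show "continuous_on U (\<lambda>y. \<psi> y *\<^sub>R F y)"
      using assms by (auto intro!: continuous_intros intro: continuous_on_subset)
    have "continuous_on (- K) (\<lambda>y. \<psi> y *\<^sub>R F y) = continuous_on (- K) (\<lambda>y. 0::'b)"
      using assms by (intro continuous_on_cong) auto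
    then show "continuous_on (- K) (\<lambda>y. \<psi> y *\<^sub>R F y)"
      by simp
  qed (use assms in auto)
  moreover have "U \<union> - K = UNIV" using assms by auto
  ultimately show ?thesis by simp
qed

text \<open>The product of \<open>\<psi>\<close> and \<open>F\<close> is a compactly supported
  function on the whole space, so its directional derivative integrates to zero by
  \<open>integral_dir_deriv_eq_0\<close>.\<close>

lemma integral_by_parts_dir_deriv:
  fixes F :: "'a::euclidean_space \<Rightarrow> 'b::euclidean_space"
  assumes U: "open U" and K: "closed K" "K \<subseteq> cbox a b" "cbox a b \<subseteq> U"
    and F: "continuous_on U F" "continuous_on U dF" "\<And>y. y \<in> U \<Longrightarrow> has_dir_deriv F u (dF y) y"
    and \<psi>: "continuous_on UNIV \<psi>" "continuous_on UNIV d\<psi>" "\<And>y. has_dir_deriv \<psi> u (d\<psi> y) y"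
    and supp: "\<And>y. y \<notin> K \<Longrightarrow> \<psi> y = 0"
  shows "integral (cbox a b) (\<lambda>y. \<psi> y *\<^sub>R dF y) = - integral (cbox a b) (\<lambda>y. d\<psi> y *\<^sub>R F y)"
proof -
  have KU: "K \<subseteq> U" using K by auto
  have supp': "d\<psi> y = 0" if "y \<notin> K" for y
    using has_dir_deriv_eq_0_outside[OF K(1) supp \<psi>(3) that] .
  have cont: "continuous_on UNIV (\<lambda>y. \<psi> y *\<^sub>R F y)" "continuous_on UNIV (\<lambda>y. \<psi> y *\<^sub>R dF y)"
    "continuous_on UNIV (\<lambda>y. d\<psi> y *\<^sub>R F y)"
    using supp supp' by (auto intro!: continuous_on_UNIV_scaleR_support[OF U K(1) KU] F \<psi>)
  have "integral (cbox a b) (\<lambda>y. \<psi> y *\<^sub>R dF y + d\<psi> y *\<^sub>R F y) = 0"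
  proof (rule integral_dir_deriv_eq_0[of "\<lambda>y. \<psi> y *\<^sub>R F y" _ u])
    show "has_dir_deriv (\<lambda>y. \<psi> y *\<^sub>R F y) u (\<psi> y *\<^sub>R dF y + d\<psi> y *\<^sub>R F y) y" for y
    \<comment> \<open>On \<open>K\<close> the product rule applies. Off \<open>K\<close> the product
      vanishes in a whole neighbourhood, because \<open>K\<close> is closed.\<close>
    proof (cases "y \<in> K")
      case True
      then have "y \<in> U" using KU by auto
      from has_vector_derivative_scaleR[of "\<lambda>t. \<psi> (y + t *\<^sub>R u)" "d\<psi> y" 0 UNIV "\<lambda>t. F (y + t *\<^sub>R u)" "dF y"]
        F(3)[OF this] \<psi>(3)[of y]
      show ?thesis
        by (simp add: has_dir_deriv_def has_real_derivative_iff_has_vector_derivative)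
    next
      case False
      have "has_dir_deriv (\<lambda>y. \<psi> y *\<^sub>R F y) u 0 y"
        using False K(1) supp by (intro has_dir_deriv_locally_zero[of "- K"]) auto
      then show ?thesis using False supp supp' by simp
    qed
    show "continuous_on UNIV (\<lambda>y. \<psi> y *\<^sub>R dF y + d\<psi> y *\<^sub>R F y)"
      by (intro continuous_on_add cont)
    show "y \<notin> cbox a b \<Longrightarrow> \<psi> y *\<^sub>R F y = 0"
      "y \<notin> cbox a b \<Longrightarrow> \<psi> y *\<^sub>R dF y + d\<psi> y *\<^sub>R F y = 0" for y
      using K supp[of y] supp'[of y] by (metis add.left_neutral scaleR_zero_left subsetD)+
  qed (rule cont)
  moreover have "(\<lambda>y. \<psi> y *\<^sub>R dF y) integrable_on cbox a b" "(\<lambda>y. d\<psi> y *\<^sub>R F y) integrable_on cbox a b"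
    by (auto intro!: integrable_continuous continuous_on_subset[OF cont(2)] continuous_on_subset[OF cont(3)])
  ultimately show ?thesis
    by (simp add: integral_add add_eq_0_iff)
qed

section \<open>Bump functions\<close>

text \<open>The only delicate point is the kink at \<open>0\<close>, where the difference quotient
  equals \<open>max 0 t ^ Suc n\<close> and tends to \<open>0\<close>.\<close>

lemma DERIV_max_0_power:
  fixes s :: real
  shows "((\<lambda>s. max 0 s ^ Suc (Suc n)) has_field_derivative real (Suc (Suc n)) * max 0 s ^ Suc n) (at s)"
proof -
  consider "s > 0" | "s < 0" | "s = 0" by linarith
  then show ?thesis
  proof cases
    case 1
    have "((\<lambda>s. s ^ Suc (Suc n)) has_field_derivative real (Suc (Suc n)) * max 0 s ^ Suc n) (at s)"
      using 1 DERIV_pow[of "Suc (Suc n)" s] by simp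
    then show ?thesis
      by (rule has_field_derivative_transform_within_open[of _ _ _ "{0<..}"]) (use 1 in auto)
  next
    case 2
    have "((\<lambda>s. 0) has_field_derivative real (Suc (Suc n)) * max 0 s ^ Suc n) (at s)"
      using 2 by simp
    then show ?thesis
      by (rule has_field_derivative_transform_within_open[of _ _ _ "{..<0}"]) (use 2 in auto)
  next
    case 3
    have "((\<lambda>t::real. max 0 t ^ Suc n) \<longlongrightarrow> max 0 0 ^ Suc n) (at 0)"
      by (intro tendsto_intros)
    moreover have "max 0 t ^ Suc n = (max 0 (0 + t) ^ Suc (Suc n) - max 0 0 ^ Suc (Suc n)) / t"
      if "t \<noteq> 0" for t :: real
      using that by (cases "t > 0") (auto simp: max_def)
    ultimately have "((\<lambda>t::real. (max 0 (0 + t) ^ Suc (Suc n) - max 0 0 ^ Suc (Suc n)) / t) \<longlongrightarrow> 0) (at 0)"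
      by (auto elim!: Lim_transform_eventually intro: eventually_at_filter[THEN iffD2])
    then show ?thesis
      unfolding DERIV_def 3 by simp
  qed
qed

text \<open>For \<open>r > 0\<close> this is positive exactly on the open ball, and polynomial
  there, so derivatives and bounds are explicit. The kernel built from it is not normalised: its
  height is \<open>r ^ 6\<close> and its first derivatives are of size \<open>r ^ 5\<close>.\<close>

definition bump0 :: "real \<Rightarrow> 'a::euclidean_space \<Rightarrow> 'a \<Rightarrow> real" where
  "bump0 r x y = max 0 (r\<^sup>2 - (y - x) \<bullet> (y - x))"

text \<open>The cube makes \<open>bump r x\<close> a function of class \<open>C\<^sup>2\<close>; \<open>bump1\<close> and \<open>bump2\<close> are its first and
  second directional derivatives.\<close>

definition bump :: "real \<Rightarrow> 'a::euclidean_space \<Rightarrow> 'a \<Rightarrow> real" where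
  "bump r x y = bump0 r x y ^ 3"

definition bump1 :: "real \<Rightarrow> 'a::euclidean_space \<Rightarrow> 'a \<Rightarrow> 'a \<Rightarrow> real" where
  "bump1 r x u y = - 6 * bump0 r x y ^ 2 * ((y - x) \<bullet> u)"

definition bump2 :: "real \<Rightarrow> 'a::euclidean_space \<Rightarrow> 'a \<Rightarrow> 'a \<Rightarrow> 'a \<Rightarrow> real" where
  "bump2 r x u w y = 24 * bump0 r x y * ((y - x) \<bullet> u) * ((y - x) \<bullet> w) - 6 * bump0 r x y ^ 2 * (u \<bullet> w)"

lemma bump0_nonneg: "bump0 r x y \<ge> 0"
  by (simp add: bump0_def)

lemma bump0_eq_0:
  assumes "y \<notin> ball x r" "r > 0"
  shows "bump0 r x y = 0"
proof -
  have "r\<^sup>2 \<le> (norm (y - x))\<^sup>2"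
    using assms by (intro power_mono) (auto simp: dist_norm norm_minus_commute)
  then show ?thesis by (simp add: bump0_def power2_norm_eq_inner)
qed

lemma bump_nonneg: "bump r x y \<ge> 0"
  by (simp add: bump_def bump0_nonneg)

lemma bump_eq_0: "y \<notin> ball x r \<Longrightarrow> r > 0 \<Longrightarrow> bump r x y = 0"
  by (simp add: bump_def bump0_eq_0)

lemma bump1_eq_0: "y \<notin> ball x r \<Longrightarrow> r > 0 \<Longrightarrow> bump1 r x u y = 0"
  by (simp add: bump1_def bump0_eq_0)

lemma bump2_commute: "bump2 r x u w y = bump2 r x w u y"
  by (simp add: bump2_def inner_commute)

text \<open>The kernel is even in \<open>y - x\<close> and its first derivative is odd. These two
  identities turn derivatives in the centre into derivatives in the argument.\<close>

lemma bump_commute: "bump r x y = bump r y x"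
  by (simp add: bump_def bump0_def inner_diff inner_commute algebra_simps)

lemma bump1_commute: "bump1 r x u y = - bump1 r y u x"
  by (simp add: bump1_def bump0_def inner_diff inner_commute algebra_simps)

lemma bump_continuous [continuous_intros]:
  assumes "continuous_on S f" "continuous_on S g"
  shows "continuous_on S (\<lambda>p. bump r (f p) (g p))"
  unfolding bump_def bump0_def by (intro continuous_intros assms)

lemma bump1_continuous [continuous_intros]:
  assumes "continuous_on S f" "continuous_on S g"
  shows "continuous_on S (\<lambda>p. bump1 r (f p) u (g p))"
  unfolding bump1_def bump0_def by (intro continuous_intros assms)

lemma bump2_continuous [continuous_intros]:
  assumes "continuous_on S f" "continuous_on S g"
  shows "continuous_on S (\<lambda>p. bump2 r (f p) u w (g p))"
  unfolding bump2_def bump0_def by (intro continuous_intros assms)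

lemma DERIV_inner_self_line:
  fixes x y u :: "'a::real_inner"
  shows "((\<lambda>t. c - (y + t *\<^sub>R u - x) \<bullet> (y + t *\<^sub>R u - x)) has_field_derivative - 2 * ((y - x) \<bullet> u)) (at 0)"
proof -
  have "(y + t *\<^sub>R u - x) \<bullet> (y + t *\<^sub>R u - x) = (y - x) \<bullet> (y - x) + 2 * t * ((y - x) \<bullet> u) + t\<^sup>2 * (u \<bullet> u)" for t
    by (simp add: inner_add inner_diff algebra_simps power2_eq_square inner_commute)
  then show ?thesis
    by (auto intro!: derivative_eq_intros)
qed

lemma bump_has_dir_deriv: "has_dir_deriv (bump r x) u (bump1 r x u y) y"
proof -
  note 1 = DERIV_inner_self_line[of "r\<^sup>2" y u x]
  have 2: "((\<lambda>s. max 0 s ^ 3) has_field_derivative 3 * max 0 s ^ 2) (at s)" for s :: real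
    using DERIV_max_0_power[of 1 s] by (simp add: numeral_eq_Suc)
  show ?thesis
    unfolding has_dir_deriv_def has_real_derivative_iff_has_vector_derivative[symmetric] bump_def bump0_def
    by (rule DERIV_cong[OF DERIV_chain2[OF 2 1]]) (simp add: bump1_def bump0_def)
qed

lemma bump1_has_dir_deriv: "has_dir_deriv (bump1 r x u) w (bump2 r x u w y) y"
proof -
  note 1 = DERIV_inner_self_line[of "r\<^sup>2" y w x]
  have 2: "((\<lambda>s. max 0 s ^ 2) has_field_derivative 2 * max 0 s) (at s)" for s :: real
    using DERIV_max_0_power[of 0 s] by (simp add: numeral_eq_Suc)
  have 3: "((\<lambda>t. (y + t *\<^sub>R w - x) \<bullet> u) has_field_derivative (u \<bullet> w)) (at 0)"
    by (simp add: inner_add_left inner_diff_left) (auto intro!: derivative_eq_intros simp: inner_commute)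
  have 4: "((\<lambda>t. bump1 r x u (y + t *\<^sub>R w)) has_field_derivative
     - 6 * (2 * bump0 r x y * (- 2 * ((y - x) \<bullet> w))) * ((y - x) \<bullet> u) + (u \<bullet> w) * (- 6 * bump0 r x y ^ 2)) (at 0)"
    unfolding bump1_def bump0_def
    by (rule DERIV_cong[OF DERIV_mult[OF DERIV_cmult[OF DERIV_chain2[OF 2 1]] 3]]) simp
  show ?thesis
    unfolding has_dir_deriv_def has_real_derivative_iff_has_vector_derivative[symmetric]
    by (rule DERIV_cong[OF 4]) (simp add: bump2_def algebra_simps)
qed

text \<open>Inside the ball the squared factor contributes \<open>r ^ 4\<close> and the inner
  product \<open>r * norm u\<close>; outside, the derivative vanishes.\<close>

lemma bump1_bound:
  assumes "r > 0"
  shows "\<bar>bump1 r x u y\<bar> \<le> 6 * r ^ 5 * norm u"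
proof (cases "y \<in> ball x r")
  case False
  then show ?thesis using assms by (simp add: bump1_eq_0)
next
  case True
  have "bump0 r x y \<le> r\<^sup>2"
    by (simp add: bump0_def)
  then have "bump0 r x y ^ 2 \<le> (r\<^sup>2) ^ 2"
    by (intro power_mono bump0_nonneg)
  moreover have "\<bar>(y - x) \<bullet> u\<bar> \<le> r * norm u"
    using Cauchy_Schwarz_ineq2[of "y - x" u] True
    by (smt (verit) dist_norm mem_ball mult_right_mono norm_ge_zero norm_minus_commute)
  ultimately have "bump0 r x y ^ 2 * \<bar>(y - x) \<bullet> u\<bar> \<le> (r\<^sup>2) ^ 2 * (r * norm u)"
    by (intro mult_mono) auto
  then show ?thesis
    by (simp add: bump1_def abs_mult numeral_eq_Suc ac_simps)
qed

lemma bump_has_integral_UNIV: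
  assumes "r > 0" "cball x r \<subseteq> cbox a b"
  shows "(bump r x has_integral integral (cbox a b) (bump r x)) UNIV"
proof (rule has_integral_UNIV_cbox_support)
  show "continuous_on (cbox a b) (bump r x)"
    by (intro continuous_intros)
  show "bump r x y = 0" if "y \<notin> cbox a b" for y
    using that assms ball_subset_cball[of x r] by (intro bump_eq_0) blast+
qed

lemma integral_bump_cbox:
  assumes "r > 0" "cball x r \<subseteq> cbox a b"
  shows "integral (cbox a b) (bump r x) = integral UNIV (bump r x)"
  using bump_has_integral_UNIV[OF assms] by (simp add: integral_unique)

lemma bump_integrable_UNIV:
  assumes "r > 0" shows "bump r x integrable_on UNIV"
proof -
  obtain a where "cball x r \<subseteq> cbox (-a) a"
    using bounded_subset_cbox_symmetric[OF bounded_cball] by blast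
  from bump_has_integral_UNIV[OF assms this] show ?thesis by (rule has_integral_integrable)
qed

lemma integral_bump_translation:
  fixes x :: "'a::euclidean_space"
  assumes "r > 0" shows "integral UNIV (bump r x) = integral UNIV (bump r (0::'a))"
proof -
  obtain a where a: "cball (0::'a) r \<subseteq> cbox (-a) a"
    using bounded_subset_cbox_symmetric[OF bounded_cball] by blast
  have "integral UNIV (\<lambda>y. bump r 0 (y + - x)) = integral UNIV (bump r (0::'a))"
  proof (rule integral_UNIV_translation)
    show "continuous_on (cbox (-a) a) (bump r 0)"
      by (intro continuous_intros)
    show "bump r 0 y = 0" if "y \<notin> cbox (-a) a" for y
      using that a assms ball_subset_cball[of 0 r] by (intro bump_eq_0) blast+
  qed
  moreover have "(\<lambda>y. bump r 0 (y + - x)) = bump r x"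
    by (simp add: fun_eq_iff bump_def bump0_def)
  ultimately show ?thesis
    by simp
qed

text \<open>On the ball of half the radius \<open>bump0\<close> is at least 3/4 of the squared
  radius, and 27/64 is the cube of 3/4. So the integral is at least of order
  \<open>r ^ 6 * r ^ DIM('a)\<close>.\<close>

lemma integral_bump_lower_bound:
  fixes x :: "'a::euclidean_space"
  assumes "r > 0"
  shows "(27 / 64) * r ^ 6 * measure lebesgue (ball x (r / 2)) \<le> integral UNIV (bump r x)"
proof -
  have int: "(indicator (ball x (r / 2)) :: 'a \<Rightarrow> real) integrable_on UNIV"
    by (simp add: measurable_integrable[symmetric])
  have "integral UNIV (\<lambda>y. (27 / 64) * r ^ 6 * indicator (ball x (r / 2)) y) \<le> integral UNIV (bump r x)"
  proof (rule integral_le)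
    show "(\<lambda>y. (27 / 64) * r ^ 6 * indicator (ball x (r / 2)) y) integrable_on UNIV"
      by (intro integrable_on_mult_right int)
    show "bump r x integrable_on UNIV"
      by (rule bump_integrable_UNIV[OF assms])
    show "(27 / 64) * r ^ 6 * indicator (ball x (r / 2)) y \<le> bump r x y" for y
    proof (cases "y \<in> ball x (r / 2)")
      case True
      then have "(norm (y - x))\<^sup>2 \<le> (r / 2)\<^sup>2"
        by (intro power_mono) (auto simp: dist_norm norm_minus_commute)
      then have "3 / 4 * r\<^sup>2 \<le> bump0 r x y"
        unfolding bump0_def power2_norm_eq_inner[symmetric]
        by (intro max.coboundedI2) (simp add: power_divide)
      then have "(3 / 4 * r\<^sup>2) ^ 3 \<le> bump r x y"
        unfolding bump_def by (intro power_mono) auto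
      then show ?thesis
        using True by (simp add: power_mult_distrib power_divide power_mult[symmetric])
    qed (simp add: bump_nonneg)
  qed
  then show ?thesis
    by (simp add: lmeasure_integral_UNIV[symmetric])
qed

lemma integral_bump_pos:
  assumes "r > 0"
  shows "0 < integral UNIV (bump r x)"
proof -
  have "0 < (27 / 64) * r ^ 6 * measure lebesgue (ball x (r / 2))"
    using assms by (intro mult_pos_pos) (auto simp: content_ball_pos)
  also have "\<dots> \<le> integral UNIV (bump r x)"
    by (rule integral_bump_lower_bound[OF assms])
  finally show ?thesis .
qed

section \<open>Mollification\<close>

text \<open>The integral runs over a fixed box because \<open>F\<close> is known to be continuous
  only there. When the ball of radius \<open>r\<close> around \<open>y\<close> lies in the box, this
  is the usual convolution average.\<close>

definition mollify :: "real \<Rightarrow> 'a \<Rightarrow> 'a \<Rightarrow> ('a::euclidean_space \<Rightarrow> 'b::euclidean_space) \<Rightarrow> 'a \<Rightarrow> 'b" where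
  "mollify r a b F y = (1 / integral UNIV (bump r (0::'a))) *\<^sub>R integral (cbox a b) (\<lambda>z. bump r y z *\<^sub>R F z)"

text \<open>The derivative of \<open>mollify\<close> in direction \<open>u\<close>. The minus sign
  arises because the kernel is differentiated in its centre, see
  \<open>bump1_commute\<close>.\<close>

definition mollify1 :: "real \<Rightarrow> 'a \<Rightarrow> 'a \<Rightarrow> ('a::euclidean_space \<Rightarrow> 'b::euclidean_space) \<Rightarrow> 'a \<Rightarrow> 'a \<Rightarrow> 'b" where
  "mollify1 r a b F u y = (- 1 / integral UNIV (bump r (0::'a))) *\<^sub>R integral (cbox a b) (\<lambda>z. bump1 r y u z *\<^sub>R F z)"

text \<open>\<open>mollify\<close> is a weighted average over the ball, with total weight one.
  Taking \<open>p = F y\<close> yields convergence, and \<open>p = 0\<close> yields bounds uniform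
  in \<open>r\<close>.\<close>

lemma mollify_estimate:
  fixes F :: "'a::euclidean_space \<Rightarrow> 'b::euclidean_space"
  assumes r: "r > 0" "cball y r \<subseteq> cbox a b" and F: "continuous_on (cbox a b) F"
    and le: "\<And>z. z \<in> ball y r \<Longrightarrow> norm (F z - p) \<le> \<delta>"
  shows "norm (mollify r a b F y - p) \<le> \<delta>"
proof -
  define c where "c = integral UNIV (bump r (0::'a))"
  have c: "c > 0" "integral (cbox a b) (bump r y) = c"
    using r by (simp_all add: c_def integral_bump_pos integral_bump_cbox integral_bump_translation[of _ y])
  have int: "(\<lambda>z. bump r y z *\<^sub>R F z) integrable_on cbox a b" "bump r y integrable_on cbox a b"
    "(\<lambda>z. bump r y z *\<^sub>R p) integrable_on cbox a b"
    by (auto intro!: integrable_continuous continuous_intros F)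
  have "integral (cbox a b) (\<lambda>z. bump r y z *\<^sub>R F z) - c *\<^sub>R p
      = integral (cbox a b) (\<lambda>z. bump r y z *\<^sub>R F z) - integral (cbox a b) (\<lambda>z. bump r y z *\<^sub>R p)"
    using integral_unique[OF has_integral_scaleR_left[OF integrable_integral[OF int(2)], of p]] c by simp
  also have "\<dots> = integral (cbox a b) (\<lambda>z. bump r y z *\<^sub>R (F z - p))"
    using int by (simp add: integral_diff[symmetric] scaleR_diff_right)
  finally have eq: "integral (cbox a b) (\<lambda>z. bump r y z *\<^sub>R F z) - c *\<^sub>R p
      = integral (cbox a b) (\<lambda>z. bump r y z *\<^sub>R (F z - p))" .
  have "norm (integral (cbox a b) (\<lambda>z. bump r y z *\<^sub>R (F z - p))) \<le> integral (cbox a b) (\<lambda>z. bump r y z * \<delta>)"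
  proof (rule integral_norm_bound_integral)
    show "(\<lambda>z. bump r y z *\<^sub>R (F z - p)) integrable_on cbox a b" "(\<lambda>z. bump r y z * \<delta>) integrable_on cbox a b"
      by (auto intro!: integrable_continuous continuous_intros F)
    show "norm (bump r y z *\<^sub>R (F z - p)) \<le> bump r y z * \<delta>" for z
      using le[of z] r(1) by (cases "z \<in> ball y r") (auto simp: bump_nonneg bump_eq_0 intro: mult_left_mono)
  qed
  also have "\<dots> = c * \<delta>"
    using c by simp
  finally have est: "norm (integral (cbox a b) (\<lambda>z. bump r y z *\<^sub>R F z) - c *\<^sub>R p) \<le> c * \<delta>"
    by (simp add: eq)
  have "mollify r a b F y - p = (1 / c) *\<^sub>R (integral (cbox a b) (\<lambda>z. bump r y z *\<^sub>R F z) - c *\<^sub>R p)"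
    using c by (simp add: mollify_def c_def[symmetric] scaleR_diff_right)
  then have "norm (mollify r a b F y - p) \<le> (1 / c) * (c * \<delta>)"
    using est c by (simp add: divide_le_eq mult.commute)
  then show ?thesis using c by simp
qed

lemma mollify_continuous:
  assumes F: "continuous_on (cbox a b) F"
  shows "continuous_on UNIV (mollify r a b F)"
proof -
  have "continuous_on UNIV (\<lambda>y. integral (cbox a b) (\<lambda>z. bump r y z *\<^sub>R F z))"
    by (rule integral_continuous_on_param)
      (auto simp: split_beta intro!: continuous_intros continuous_on_compose2[OF F])
  then show ?thesis unfolding mollify_def by (intro continuous_intros)
qed

lemma mollify1_continuous:
  assumes F: "continuous_on (cbox a b) F"
  shows "continuous_on UNIV (mollify1 r a b F u)"
proof -
  have "continuous_on UNIV (\<lambda>y. integral (cbox a b) (\<lambda>z. bump1 r y u z *\<^sub>R F z))"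
    by (rule integral_continuous_on_param)
      (auto simp: split_beta intro!: continuous_intros continuous_on_compose2[OF F])
  then show ?thesis unfolding mollify1_def by (intro continuous_intros)
qed

text \<open>Differentiation under the integral: the derivative falls on the kernel, so continuity of
  \<open>F\<close> suffices.\<close>

lemma mollify_has_dir_deriv:
  assumes F: "continuous_on (cbox a b) F"
  shows "has_dir_deriv (mollify r a b F) u (mollify1 r a b F u y) y"
proof -
  have "((\<lambda>t. integral (cbox a b) (\<lambda>z. bump r (y + t *\<^sub>R u) z *\<^sub>R F z)) has_vector_derivative
      integral (cbox a b) (\<lambda>z. (- bump1 r (y + 0 *\<^sub>R u) u z) *\<^sub>R F z)) (at 0 within UNIV)"
  proof (rule leibniz_rule_vector_derivative)
    fix t z
    have "((\<lambda>t. bump r z (y + t *\<^sub>R u)) has_vector_derivative bump1 r z u (y + t *\<^sub>R u)) (at t)"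
      by (rule has_dir_deriv_along_line[OF bump_has_dir_deriv])
    then have "((\<lambda>t. bump r (y + t *\<^sub>R u) z) has_field_derivative - bump1 r (y + t *\<^sub>R u) u z) (at t)"
      by (subst bump_commute, subst bump1_commute) (simp add: has_real_derivative_iff_has_vector_derivative)
    from has_vector_derivative_scaleR[OF this has_vector_derivative_const[of "F z"]]
    show "((\<lambda>t. bump r (y + t *\<^sub>R u) z *\<^sub>R F z) has_vector_derivative
        (- bump1 r (y + t *\<^sub>R u) u z) *\<^sub>R F z) (at t within UNIV)"
      by simp
  next
    show "(\<lambda>z. bump r (y + t *\<^sub>R u) z *\<^sub>R F z) integrable_on cbox a b" for t
      by (auto intro!: integrable_continuous continuous_intros F)
    show "continuous_on (UNIV \<times> cbox a b) (\<lambda>(t, z). (- bump1 r (y + t *\<^sub>R u) u z) *\<^sub>R F z)"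
      by (auto simp: split_beta intro!: continuous_intros continuous_on_compose2[OF F])
  qed auto
  then have "((\<lambda>t. integral (cbox a b) (\<lambda>z. bump r (y + t *\<^sub>R u) z *\<^sub>R F z)) has_vector_derivative
      - integral (cbox a b) (\<lambda>z. bump1 r y u z *\<^sub>R F z)) (at 0)"
    by simp
  from has_vector_derivative_scaleR[OF DERIV_const[of "1 / integral UNIV (bump r (0::'a))"] this]
  show ?thesis
    by (simp add: has_dir_deriv_def mollify_def mollify1_def)
qed

text \<open>Integrating by parts moves the derivative of \<open>g\<close> onto the kernel, whose Hessian is symmetric.\<close>
lemma mollify1_derivative_commute:
  fixes g :: "'a::euclidean_space \<Rightarrow> 'b::euclidean_space"
  assumes U: "open U" "cbox a b \<subseteq> U" and r: "r > 0" "cball y r \<subseteq> cbox a b"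
    and g: "\<And>z. z \<in> U \<Longrightarrow> (g has_derivative Dg z) (at z)"
    and Dg: "\<And>u. continuous_on U (\<lambda>z. Dg z u)"
  shows "mollify1 r a b (\<lambda>z. Dg z u) w y = mollify1 r a b (\<lambda>z. Dg z w) u y"
proof -
  have "integral (cbox a b) (\<lambda>z. bump1 r y w z *\<^sub>R Dg z u) = - integral (cbox a b) (\<lambda>z. bump2 r y w u z *\<^sub>R g z)"
    for u w
  proof (rule integral_by_parts_dir_deriv[OF U(1) closed_cball r(2) U(2)])
    show "continuous_on U g"
      using g by (intro continuous_at_imp_continuous_on) (auto intro: has_derivative_continuous)
    show "bump1 r y w z = 0" if "z \<notin> cball y r" for z
      using that r(1) ball_subset_cball[of y r] by (intro bump1_eq_0) blast+
    show "has_dir_deriv g u (Dg z u) z" if "z \<in> U" for z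
      by (rule has_derivative_imp_has_dir_deriv[OF g[OF that]])
  qed (auto intro!: continuous_intros Dg bump1_has_dir_deriv)
  then show ?thesis
    by (simp add: mollify1_def bump2_commute[of r y w])
qed

lemma mollify_tendsto:
  fixes F :: "'a::euclidean_space \<Rightarrow> 'b::euclidean_space"
  assumes F: "continuous_on (cbox a b) F" and e: "e > 0" "cball y e \<subseteq> cbox a b"
  shows "(\<lambda>n. mollify (e / real (Suc n)) a b F y) \<longlonglongrightarrow> F y"
proof (rule metric_LIMSEQ_I)
  fix \<delta> :: real assume "\<delta> > 0"
  have "y \<in> cbox a b" using e by auto
  with F \<open>\<delta> > 0\<close> obtain d where d: "d > 0" "\<And>z. z \<in> cbox a b \<Longrightarrow> dist z y < d \<Longrightarrow> dist (F z) (F y) < \<delta> / 2"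
    unfolding continuous_on_iff by (meson half_gt_zero)
  have "(\<lambda>n. e / real (Suc n)) \<longlonglongrightarrow> 0"
    using tendsto_mult[OF tendsto_const[of e] LIMSEQ_inverse_real_of_nat] by (simp add: divide_inverse)
  then have "eventually (\<lambda>n. e / real (Suc n) < d) sequentially"
    using d(1) by (rule order_tendstoD)
  then obtain N where N: "\<And>n. n \<ge> N \<Longrightarrow> e / real (Suc n) < d"
    by (auto simp: eventually_sequentially)
  have "dist (mollify (e / real (Suc n)) a b F y) (F y) < \<delta>" if "n \<ge> N" for n
  proof -
    have sub: "cball y (e / real (Suc n)) \<subseteq> cbox a b"
      using e by (intro order_trans[OF subset_cball e(2)]) (simp add: divide_le_eq)
    have "norm (mollify (e / real (Suc n)) a b F y - F y) \<le> \<delta> / 2"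
    proof (rule mollify_estimate[OF _ sub F])
      fix z assume z: "z \<in> ball y (e / real (Suc n))"
      then have "z \<in> cbox a b" using sub by auto
      moreover have "dist z y < d" using z N[OF that] by (simp add: dist_commute)
      ultimately show "norm (F z - F y) \<le> \<delta> / 2" using d(2)[of z] by (simp add: dist_norm)
    qed (use e in auto)
    with \<open>\<delta> > 0\<close> show ?thesis by (simp add: dist_norm)
  qed
  then show "\<exists>N. \<forall>n\<ge>N. dist (mollify (e / real (Suc n)) a b F y) (F y) < \<delta>" by blast
qed

section \<open>Weakly closed forms\<close>

lemma sum_alternating_ext:
  "(\<Sum>i\<in>I. (-1) ^ i * (\<Sum>j\<in>J. (-1) ^ j * F i j)) = (\<Sum>i\<in>I. \<Sum>j\<in>J. (-1) ^ (i + j) * (F i j :: real))"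
  by (simp add: sum_distrib_left power_add mult.assoc)

text \<open>The weak form of d(d lam) = 0 for a form that can be differentiated only once.
  Integration by parts moves the second derivative onto the bump function, where
  \<open>bump2\<close> is symmetric in its two directions, and the double sum over omitted indices
  cancels.\<close>

lemma integral_bump1_ext_d_eq_0:
  fixes lam :: "'a::euclidean_space \<Rightarrow> (nat \<Rightarrow> 'a) \<Rightarrow> real"
  assumes U: "open U" "cbox a b \<subseteq> U" and r: "r > 0" "cball x r \<subseteq> cbox a b"
    and lam: "\<And>v y. y \<in> U \<Longrightarrow> ((\<lambda>y. lam y v) has_derivative frechet_derivative (\<lambda>y. lam y v) (at y)) (at y)"
    and cont: "\<And>v u. continuous_on U (\<lambda>y. frechet_derivative (\<lambda>y. lam y v) (at y) u)"
  shows "(\<Sum>i\<le>Suc p. (-1) ^ i * integral (cbox a b) (\<lambda>y. bump1 r x (v i) y * ext_d p lam y (skip i v))) = 0"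
proof -
  define D where "D v y u = frechet_derivative (\<lambda>y. lam y v) (at y) u" for v y u
  define F where "F i j = - integral (cbox a b) (\<lambda>y. bump2 r x (v i) (skip i v j) y * lam y (skip j (skip i v)))" for i j
  have contD: "continuous_on (cbox a b) (\<lambda>y. D v y u)" for v u
    unfolding D_def by (rule continuous_on_subset[OF cont U(2)])
  have parts: "integral (cbox a b) (\<lambda>y. bump1 r x w y * D v y u) =
      - integral (cbox a b) (\<lambda>y. bump2 r x w u y * lam y v)" for u v w
    unfolding real_scaleR_def[symmetric]
  proof (rule integral_by_parts_dir_deriv[OF U(1) closed_cball r(2) U(2)])
    show "continuous_on U (\<lambda>y. lam y v)"
      using lam by (intro continuous_at_imp_continuous_on) (auto intro: has_derivative_continuous)
    show "bump1 r x w z = 0" if "z \<notin> cball x r" for z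
      using that r(1) ball_subset_cball[of x r] by (intro bump1_eq_0) blast+
    show "has_dir_deriv (\<lambda>y. lam y v) u (D v z u) z" if "z \<in> U" for z
      unfolding D_def by (rule has_derivative_imp_has_dir_deriv[OF lam[OF that]])
    show "continuous_on U (\<lambda>y. D v y u)"
      unfolding D_def by (rule cont)
  qed (auto intro!: continuous_intros bump1_has_dir_deriv)
  have "integral (cbox a b) (\<lambda>y. bump1 r x (v i) y * ext_d p lam y (skip i v)) = (\<Sum>j<Suc p. (-1) ^ j * F i j)" for i
  proof -
    have "integral (cbox a b) (\<lambda>y. bump1 r x (v i) y * ext_d p lam y (skip i v)) = integral (cbox a b)
        (\<lambda>y. \<Sum>j<Suc p. (-1) ^ j * (bump1 r x (v i) y * D (skip j (skip i v)) y (skip i v j)))"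
      unfolding ext_d_def D_def lessThan_Suc_atMost by (simp add: sum_distrib_left ac_simps)
    also have "\<dots> =
        (\<Sum>j<Suc p. integral (cbox a b) (\<lambda>y. (-1) ^ j * (bump1 r x (v i) y * D (skip j (skip i v)) y (skip i v j))))"
      by (intro integral_sum) (auto intro!: integrable_continuous continuous_intros contD)
    also have "\<dots> = (\<Sum>j<Suc p. (-1) ^ j * F i j)"
      unfolding F_def by (intro sum.cong refl) (simp only: integral_mult_right parts)
    finally show ?thesis .
  qed
  then have "(\<Sum>i\<le>Suc p. (-1) ^ i * integral (cbox a b) (\<lambda>y. bump1 r x (v i) y * ext_d p lam y (skip i v)))
      = (\<Sum>i\<le>Suc p. \<Sum>j<Suc p. (-1) ^ (i + j) * F i j)"
    by (simp only: sum_alternating_ext)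
  also have "\<dots> = 0"
  proof (rule double_skip_sum_eq_0)
    fix i j :: nat assume "j < i"
    then have "skip i v j = v j" "skip j v (i - 1) = v i"
      by (auto simp: skip_def)
    then show "F i j = F j (i - 1)"
      unfolding F_def by (simp add: skip_skip[OF \<open>j < i\<close>] bump2_commute[of r x "v i"])
  qed
  finally show ?thesis .
qed

text \<open>For \<open>g\<close> of class \<open>C\<^sup>2\<close> this is \<open>d (g\<^sup>* \<alpha>) = 0\<close> tested against a bump function. For \<open>g\<close> merely of
  class \<open>C\<^sup>1\<close>, the derivative \<open>Dg\<close> is mollified first.\<close>
lemma integral_bump1_pullback_const_eq_0:
  fixes g :: "'a::euclidean_space \<Rightarrow> 'b::euclidean_space"
  assumes \<alpha>: "alt_form h \<alpha>"
    and U: "open U" "cbox a b \<subseteq> U" and r: "r > 0" "cball x r \<subseteq> box a b"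
    and g: "\<And>z. z \<in> U \<Longrightarrow> (g has_derivative Dg z) (at z)"
    and Dg: "\<And>u. continuous_on U (\<lambda>z. Dg z u)"
  shows "(\<Sum>i\<le>h. (-1) ^ i * integral (cbox a b) (\<lambda>y. bump1 r x (v i) y * \<alpha> (\<lambda>k. Dg y (skip i v k)))) = 0"
proof -
  \<comment> \<open>A single radius \<open>e\<close> serves all points of the support ball, so every
    mollification with radius at most \<open>e\<close> stays inside the box.\<close>
  obtain e where e: "e > 0" "(\<Union>y\<in>cball x r. cball y e) \<subseteq> box a b"
    using compact_subset_open_imp_cball_epsilon_subset[OF compact_cball open_box r(2)] by blast
  then have e': "cball y e \<subseteq> cbox a b" if "y \<in> cball x r" for y
    using that box_subset_cbox[of a b] by blast
  have r': "cball x r \<subseteq> cbox a b"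
    using r(2) box_subset_cbox[of a b] by blast
  have contDg: "continuous_on (cbox a b) (\<lambda>z. Dg z u)" for u
    by (rule continuous_on_subset[OF Dg U(2)])
  define \<epsilon> where "\<epsilon> n = e / real (Suc n)" for n
  have \<epsilon>: "\<epsilon> n > 0" "\<epsilon> n \<le> e" for n
    using e(1) by (auto simp: \<epsilon>_def divide_le_eq)
  have sub: "cball y (\<epsilon> n) \<subseteq> cbox a b" if "y \<in> cball x r" for y n
    using e'[OF that] subset_cball[OF \<epsilon>(2)] by blast
  define W where "W n u = mollify (\<epsilon> n) a b (\<lambda>z. Dg z u)" for n u
  define W' where "W' n u w = mollify1 (\<epsilon> n) a b (\<lambda>z. Dg z u) w" for n u w
  define N where "N n i y = \<alpha> (\<lambda>k. W n (skip i v k) y)" for n i y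
  define N' where "N' n i y = (\<Sum>k<h. \<alpha> ((\<lambda>k. W n (skip i v k) y)(k := W' n (skip i v k) (v i) y)))" for n i y
  have contW: "continuous_on UNIV (W n u)" "continuous_on UNIV (W' n u w)" for n u w
    unfolding W_def W'_def by (rule mollify_continuous mollify1_continuous contDg)+
  have contN: "continuous_on UNIV (N n i)" for n i
    unfolding N_def by (intro continuous_on_alt_form[OF \<alpha>] contW)
  have contN': "continuous_on UNIV (N' n i)" for n i
    unfolding N'_def
  proof (intro continuous_on_sum continuous_on_alt_form[OF \<alpha>])
    show "continuous_on UNIV (\<lambda>y. ((\<lambda>k. W n (skip i v k) y)(k := W' n (skip i v k) (v i) y)) l)" for k l
      by (cases "l = k") (simp_all add: contW)
  qed
  have derivN: "has_dir_deriv (N n i) (v i) (N' n i y) y" for n i y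
  proof -
    have "((\<lambda>t. W n (skip i v k) (y + t *\<^sub>R v i)) has_vector_derivative W' n (skip i v k) (v i) y) (at 0)" for k
      using mollify_has_dir_deriv[OF contDg] by (simp add: has_dir_deriv_def W_def W'_def)
    then have "((\<lambda>t. \<alpha> (\<lambda>k. W n (skip i v k) (y + t *\<^sub>R v i))) has_vector_derivative
        (\<Sum>k<h. \<alpha> ((\<lambda>k. W n (skip i v k) (y + 0 *\<^sub>R v i))(k := W' n (skip i v k) (v i) y)))) (at 0)"
      by (intro alt_form_has_vector_derivative[OF \<alpha>])
    then show ?thesis by (simp add: has_dir_deriv_def N_def N'_def)
  qed
  \<comment> \<open>The mollified fields \<open>W n u\<close> inherit the symmetry of mixed
    derivatives, which is all that closedness of the pulled-back constant form requires.\<close>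
  have closedN: "(\<Sum>i\<le>h. (-1) ^ i * N' n i y) = 0" if "y \<in> cball x r" for n y
    unfolding N'_def
  proof (rule alt_form_symmetric_sum_eq_0[OF \<alpha>, of "\<lambda>w u. W' n u w y" v "\<lambda>u. W n u y"])
    show "W' n (v j) (v i) y = W' n (v i) (v j) y" for i j
      unfolding W'_def
      by (rule mollify1_derivative_commute[OF U \<epsilon>(1) sub[OF that] g Dg])
  qed
  have zero: "(\<Sum>i\<le>h. (-1) ^ i * integral (cbox a b) (\<lambda>y. bump1 r x (v i) y * N n i y)) = 0" for n
  proof -
    \<comment> \<open>Unlike the original integrand, \<open>N n i\<close> can be differentiated, so
      the derivative moves from the bump onto it and \<open>closedN\<close> applies.\<close>
    have "integral (cbox a b) (\<lambda>y. bump1 r x (v i) y * N n i y) = - integral (cbox a b) (\<lambda>y. bump r x y * N' n i y)" for i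
    proof -
      have "integral (cbox a b) (\<lambda>y. bump r x y *\<^sub>R N' n i y) = - integral (cbox a b) (\<lambda>y. bump1 r x (v i) y *\<^sub>R N n i y)"
      proof (rule integral_by_parts_dir_deriv[OF open_UNIV closed_cball r' subset_UNIV])
        show "bump r x z = 0" if "z \<notin> cball x r" for z
          using that r(1) ball_subset_cball[of x r] by (intro bump_eq_0) blast+
      qed (auto intro!: continuous_intros bump_has_dir_deriv contN contN' derivN)
      then show ?thesis by simp
    qed
    then have "(\<Sum>i\<le>h. (-1) ^ i * integral (cbox a b) (\<lambda>y. bump1 r x (v i) y * N n i y))
      = - (\<Sum>i\<le>h. integral (cbox a b) (\<lambda>y. (-1) ^ i * (bump r x y * N' n i y)))"
      by (simp add: sum_negf)
    also have "(\<Sum>i\<le>h. integral (cbox a b) (\<lambda>y. (-1) ^ i * (bump r x y * N' n i y)))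
      = integral (cbox a b) (\<lambda>y. \<Sum>i\<le>h. (-1) ^ i * (bump r x y * N' n i y))"
      by (intro integral_sum[symmetric])
        (auto intro!: integrable_continuous continuous_intros continuous_on_subset[OF contN'])
    also have "(\<lambda>y. \<Sum>i\<le>h. (-1) ^ i * (bump r x y * N' n i y)) = (\<lambda>y. 0)"
    proof
      fix y
      have "(\<Sum>i\<le>h. (-1) ^ i * (bump r x y * N' n i y)) = bump r x y * (\<Sum>i\<le>h. (-1) ^ i * N' n i y)"
        by (simp add: sum_distrib_left ac_simps)
      also have "\<dots> = 0"
        using closedN[of y n] bump_eq_0[of y x r] r(1) by (cases "y \<in> ball x r") auto
      finally show "(\<Sum>i\<le>h. (-1) ^ i * (bump r x y * N' n i y)) = 0" .
    qed
    finally show ?thesis by simp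
  qed
  \<comment> \<open>Dominated convergence: \<open>bump1\<close> vanishes off the ball, and on it the
    averages \<open>W n u\<close> obey the same bound \<open>C u\<close> as \<open>Dg\<close> does
    on the box, independently of \<open>n\<close>.\<close>
  have lim: "(\<lambda>n. integral (cbox a b) (\<lambda>y. bump1 r x (v i) y * N n i y))
      \<longlonglongrightarrow> integral (cbox a b) (\<lambda>y. bump1 r x (v i) y * \<alpha> (\<lambda>k. Dg y (skip i v k)))" for i
  proof -
    have "\<exists>C. \<forall>z\<in>cbox a b. norm (Dg z u) \<le> C" for u
      using compact_imp_bounded[OF compact_continuous_image[OF contDg[of u] compact_cbox]]
      by (auto simp: bounded_iff)
    then obtain C where C: "\<And>u z. z \<in> cbox a b \<Longrightarrow> norm (Dg z u) \<le> C u"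
      by metis
    define M where "M = (\<Sum>I\<in>PiE {..<h} (\<lambda>_. Basis). (\<Prod>k<h. C (skip i v k)) * \<bar>\<alpha> I\<bar>)"
    show ?thesis
    proof (rule dominated_convergence(2))
      show "(\<lambda>y. bump1 r x (v i) y * N n i y) integrable_on cbox a b" for n
        by (auto intro!: integrable_continuous continuous_intros continuous_on_subset[OF contN])
      show "(\<lambda>y. \<bar>bump1 r x (v i) y\<bar> * M) integrable_on cbox a b"
        by (auto intro!: integrable_continuous continuous_intros)
      show "norm (bump1 r x (v i) y * N n i y) \<le> \<bar>bump1 r x (v i) y\<bar> * M" for n y
      proof (cases "y \<in> ball x r")
        case True
        then have y: "y \<in> cball x r" by simp
        have "norm (W n u y) \<le> C u" for u
        proof -
          have "norm (W n u y - 0) \<le> C u"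
            unfolding W_def
          proof (rule mollify_estimate[OF \<epsilon>(1) sub[OF y] contDg])
            show "norm (Dg z u - 0) \<le> C u" if "z \<in> ball y (\<epsilon> n)" for z
              using C[of z u] that sub[OF y, of n] subsetD[OF ball_subset_cball, of z y "\<epsilon> n"]
              by (metis diff_zero subsetD)
          qed
          then show ?thesis by simp
        qed
        then have "\<bar>N n i y\<bar> \<le> M"
          unfolding N_def M_def by (intro alt_form_bound[OF \<alpha>])
        then show ?thesis by (simp add: abs_mult mult_left_mono)
      qed (use r(1) in \<open>simp add: bump1_eq_0\<close>)
      show "(\<lambda>n. bump1 r x (v i) y * N n i y) \<longlonglongrightarrow> bump1 r x (v i) y * \<alpha> (\<lambda>k. Dg y (skip i v k))" for y
      proof (cases "y \<in> ball x r")
        case True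
        then have y: "y \<in> cball x r" by simp
        have "(\<lambda>n. W n u y) \<longlonglongrightarrow> Dg y u" for u
          unfolding W_def \<epsilon>_def by (rule mollify_tendsto[OF contDg e(1) e'[OF y]])
        then show ?thesis
          unfolding N_def by (intro tendsto_mult tendsto_const tendsto_alt_form[OF \<alpha>])
      qed (use r(1) in \<open>simp add: bump1_eq_0\<close>)
    qed
  qed
  have "(\<lambda>n. \<Sum>i\<le>h. (-1) ^ i * integral (cbox a b) (\<lambda>y. bump1 r x (v i) y * N n i y))
      \<longlonglongrightarrow> (\<Sum>i\<le>h. (-1) ^ i * integral (cbox a b) (\<lambda>y. bump1 r x (v i) y * \<alpha> (\<lambda>k. Dg y (skip i v k))))"
    by (intro tendsto_sum tendsto_mult tendsto_const lim)
  then show ?thesis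
    by (simp add: zero LIMSEQ_const_iff)
qed

section \<open>Points of superdensity\<close>

lemma abs_integral_le_measure:
  fixes f :: "'a::euclidean_space \<Rightarrow> real"
  assumes f: "f integrable_on cbox a b" and S: "S \<in> lmeasurable" and K: "K \<ge> 0"
    and le: "\<And>y. y \<in> cbox a b \<Longrightarrow> \<bar>f y\<bar> \<le> K * indicator S y"
  shows "\<bar>integral (cbox a b) f\<bar> \<le> K * measure lebesgue S"
proof -
  have int: "(\<lambda>y. K * indicator S y) integrable_on UNIV"
    using S by (intro integrable_on_mult_right) (simp add: measurable_integrable)
  have int': "(\<lambda>y. K * indicator S y) integrable_on cbox a b"
    by (rule integrable_on_subcbox[OF int]) simp
  have "\<bar>integral (cbox a b) f\<bar> \<le> integral (cbox a b) (\<lambda>y. K * indicator S y)"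
    using integral_norm_bound_integral[OF f int'] le by simp
  also have "\<dots> \<le> integral UNIV (\<lambda>y. K * indicator S y)"
    using K by (intro integral_subset_le int int') auto
  also have "\<dots> = K * measure lebesgue S"
    using S by (simp add: lmeasure_integral_UNIV)
  finally show ?thesis .
qed

text \<open>The measure of the bad set in \<open>superdense\<close> is meaningful only when that set is measurable
  (otherwise \<open>measure\<close> returns \<open>0\<close>), hence the assumption \<open>meas\<close>.\<close>
lemma superdense_sum_derivative_eq_0:
  fixes x :: "'a::euclidean_space" and v :: "'i \<Rightarrow> 'a" and Q N :: "'i \<Rightarrow> 'a \<Rightarrow> real"
  assumes fin: "finite I" and x: "x \<in> box a b"
    and Q: "\<And>i. i \<in> I \<Longrightarrow> continuous_on (cbox a b) (Q i)" "\<And>i. i \<in> I \<Longrightarrow> Q i x = 0"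
      "\<And>i. i \<in> I \<Longrightarrow> (Q i has_derivative A i) (at x)"
    and N: "\<And>i. i \<in> I \<Longrightarrow> continuous_on (cbox a b) (N i)"
    and weakly_closed: "\<And>r. r > 0 \<Longrightarrow> cball x r \<subseteq> box a b \<Longrightarrow>
      (\<Sum>i\<in>I. integral (cbox a b) (\<lambda>y. bump1 r x (v i) y * N i y)) = 0"
    and E: "\<And>i y. i \<in> I \<Longrightarrow> y \<in> cbox a b \<Longrightarrow> y \<in> E \<Longrightarrow> Q i y + N i y = 0"
    and meas: "\<And>r. r > 0 \<Longrightarrow> cball x r \<subseteq> box a b \<Longrightarrow> ball x r - E \<in> lmeasurable"
    and dense: "x \<in> superdense (DIM('a) + 1) E"
  shows "(\<Sum>i\<in>I. A i (v i)) = 0"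
proof -
  define D where "D = (\<Sum>i\<in>I. A i (v i))"
  define S where "S = (\<Sum>i\<in>I. norm (v i))"
  define V where "V = unit_ball_vol (real DIM('a))"
  have V: "V > 0" "measure lebesgue (ball x r) = V * r ^ DIM('a)" if "r \<ge> 0" for r
    using that content_ball[of r x] by (simp_all add: V_def unit_ball_vol_pos)
  have S: "S \<ge> 0" by (simp add: S_def sum_nonneg)
  have "\<exists>C. \<forall>y\<in>cbox a b. \<bar>Q i y + N i y\<bar> \<le> C" if "i \<in> I" for i
    using compact_imp_bounded[OF compact_continuous_image[OF continuous_on_add[OF Q(1) N] compact_cbox]] that
    by (auto simp: bounded_iff)
  then obtain C' where C': "\<And>i y. i \<in> I \<Longrightarrow> y \<in> cbox a b \<Longrightarrow> \<bar>Q i y + N i y\<bar> \<le> C' i"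
    by metis
  define C where "C = (\<Sum>i\<in>I. \<bar>C' i\<bar>)"
  have C: "C \<ge> 0" "\<And>i y. i \<in> I \<Longrightarrow> y \<in> cbox a b \<Longrightarrow> \<bar>Q i y + N i y\<bar> \<le> C"
  proof -
    show "C \<ge> 0" by (simp add: C_def sum_nonneg)
    fix i y assume i: "i \<in> I" "y \<in> cbox a b"
    have "\<bar>C' i\<bar> \<le> C"
      unfolding C_def using fin i by (intro member_le_sum) auto
    then show "\<bar>Q i y + N i y\<bar> \<le> C" using C'[OF i] by linarith
  qed
  \<comment> \<open>One \<open>\<delta>\<close> measures both small quantities: the relative measure
    of the bad set and the linearisation error of \<open>Q\<close>. The constants on both sides do
    not depend on it.\<close>
  have key: "\<bar>D\<bar> * (27 / 64 * V / 2 ^ DIM('a)) \<le> \<delta> * (6 * S * (C + V))" if \<delta>: "\<delta> > 0" for \<delta>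
  proof -
    have 1: "\<forall>\<^sub>F r in at_right 0. measure lebesgue (ball x r - E) \<le> \<delta> * r ^ (DIM('a) + 1)"
    proof -
      have "(\<lambda>r. measure lebesgue (ball x r - E)) \<in> o[at_right 0](\<lambda>r. r ^ (DIM('a) + 1))"
        using dense by (simp add: superdense_def)
      from landau_o.smallD[OF this \<delta>] show ?thesis
        using eventually_at_right_less[of 0] by eventually_elim (auto simp: abs_mult)
    qed
    obtain e where e: "e > 0" "cball x e \<subseteq> box a b"
      using x open_contains_cball[of "box a b"] by auto
    have 2: "\<forall>\<^sub>F r in at_right 0. r < e"
      using e(1) by (rule eventually_at_rightI[of 0 e, rotated]) auto
    have 3: "\<forall>\<^sub>F r in at_right 0. \<forall>i\<in>I. \<forall>y. norm (y - x) < r \<longrightarrow> \<bar>Q i y - A i (y - x)\<bar> \<le> \<delta> * norm (y - x)"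
    proof (intro eventually_ball_finite fin ballI)
      fix i assume i: "i \<in> I"
      then obtain d where d: "d > 0" "\<And>y. norm (y - x) < d \<Longrightarrow> \<bar>Q i y - A i (y - x)\<bar> \<le> \<delta> * norm (y - x)"
        using Q(3)[OF i] \<delta> unfolding has_derivative_at_alt by (auto simp: Q(2))
      show "\<forall>\<^sub>F r in at_right 0. \<forall>y. norm (y - x) < r \<longrightarrow> \<bar>Q i y - A i (y - x)\<bar> \<le> \<delta> * norm (y - x)"
        by (rule eventually_at_rightI[of 0 d]) (use d in auto)
    qed
    obtain r where r: "r > 0" "r < e" "measure lebesgue (ball x r - E) \<le> \<delta> * r ^ (DIM('a) + 1)"
      and Qr: "\<And>i y. i \<in> I \<Longrightarrow> norm (y - x) < r \<Longrightarrow> \<bar>Q i y - A i (y - x)\<bar> \<le> \<delta> * norm (y - x)"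
    proof -
      have "\<forall>\<^sub>F r in at_right 0. r > 0 \<and> r < e \<and> measure lebesgue (ball x r - E) \<le> \<delta> * r ^ (DIM('a) + 1) \<and>
          (\<forall>i\<in>I. \<forall>y. norm (y - x) < r \<longrightarrow> \<bar>Q i y - A i (y - x)\<bar> \<le> \<delta> * norm (y - x))"
        using eventually_at_right_less[of 0] 1 2 3 by eventually_elim auto
      from eventually_happens'[OF _ this] that show ?thesis by auto
    qed
    have sub: "cball x r \<subseteq> box a b" "cball x r \<subseteq> cbox a b"
      using e r(2) subset_cball[of r e x] box_subset_cbox[of a b] by (auto intro: order_trans)
    define c where "c = integral (cbox a b) (bump r x)"
    have linear: "linear (A i)" if "i \<in> I" for i
      using Q(3)[OF that] by (rule has_derivative_linear)
    have contA: "continuous_on T (\<lambda>y. A i (y - x))" if "i \<in> I" for i T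
      by (rule linear_continuous_on_compose[OF _ linear[OF that]]) (intro continuous_intros)
    \<comment> \<open>The linear part is differentiated exactly: integration by parts replaces it by
      the constant \<open>A i (v i)\<close> times the mass \<open>c\<close> of the bump.\<close>
    have parts: "integral (cbox a b) (\<lambda>y. bump1 r x (v i) y * A i (y - x)) = - c * A i (v i)" if "i \<in> I" for i
    proof -
      have "integral (cbox a b) (\<lambda>y. bump r x y *\<^sub>R A i (v i)) =
          - integral (cbox a b) (\<lambda>y. bump1 r x (v i) y *\<^sub>R A i (y - x))"
      proof (rule integral_by_parts_dir_deriv[OF open_UNIV closed_cball sub(2) subset_UNIV])
        show "bump r x z = 0" if "z \<notin> cball x r" for z
          using that r(1) ball_subset_cball[of x r] by (intro bump_eq_0) blast+
        show "has_dir_deriv (\<lambda>y. A i (y - x)) (v i) (A i (v i)) z" for z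
        proof -
          have "((\<lambda>y. A i (y - x)) has_derivative A i) (at z)"
            using has_derivative_diff[OF linear_imp_has_derivative[OF linear[OF that]] has_derivative_const]
            by (simp add: linear_diff[OF linear[OF that]])
          then show ?thesis by (rule has_derivative_imp_has_dir_deriv)
        qed
      qed (auto intro!: continuous_intros contA that bump_has_dir_deriv)
      then show ?thesis by (simp add: c_def)
    qed
    have intQ: "(\<lambda>y. bump1 r x (v i) y * Q i y) integrable_on cbox a b"
      and intN: "(\<lambda>y. bump1 r x (v i) y * N i y) integrable_on cbox a b"
      and intA: "(\<lambda>y. bump1 r x (v i) y * A i (y - x)) integrable_on cbox a b" if "i \<in> I" for i
      using that by (auto intro!: integrable_continuous continuous_intros Q(1) N contA)
    \<comment> \<open>Isolates the linear part of \<open>Q i\<close>; the \<open>N i\<close> terms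
      disappear after summation by \<open>weakly_closed\<close>.\<close>
    have split: "integral (cbox a b) (\<lambda>y. bump1 r x (v i) y * (Q i y + N i y)) =
        integral (cbox a b) (\<lambda>y. bump1 r x (v i) y * (Q i y - A i (y - x))) - c * A i (v i)
        + integral (cbox a b) (\<lambda>y. bump1 r x (v i) y * N i y)" if "i \<in> I" for i
      using integral_add[OF intQ intN] integral_diff[OF intQ intA] parts that
      by (simp add: distrib_left right_diff_distrib)
    have "(\<Sum>i\<in>I. integral (cbox a b) (\<lambda>y. bump1 r x (v i) y * (Q i y + N i y))) =
        (\<Sum>i\<in>I. integral (cbox a b) (\<lambda>y. bump1 r x (v i) y * (Q i y - A i (y - x)))) - c * D"
      using weakly_closed[OF r(1) sub(1)]
      by (simp add: split sum.distrib sum_subtractf D_def sum_distrib_left)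
    then have cD: "c * D = (\<Sum>i\<in>I. integral (cbox a b) (\<lambda>y. bump1 r x (v i) y * (Q i y - A i (y - x)))
        - integral (cbox a b) (\<lambda>y. bump1 r x (v i) y * (Q i y + N i y)))"
      by (simp add: sum_subtractf)
    \<comment> \<open>Two errors: the linearisation error, at most \<open>\<delta> * r\<close> on
      the whole ball, and the integral of \<open>Q i + N i\<close>, which lives off \<open>E\<close>
      and has only the crude bound \<open>C\<close>.\<close>
    have "\<bar>c * D\<bar> \<le> (\<Sum>i\<in>I. 6 * r ^ 5 * norm (v i) * (\<delta> * r) * measure lebesgue (ball x r)
        + 6 * r ^ 5 * norm (v i) * C * measure lebesgue (ball x r - E))"
      unfolding cD
    proof (rule order_trans[OF sum_abs sum_mono])
      fix i assume i: "i \<in> I"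
      have b1: "\<bar>integral (cbox a b) (\<lambda>y. bump1 r x (v i) y * (Q i y - A i (y - x)))\<bar> \<le>
          6 * r ^ 5 * norm (v i) * (\<delta> * r) * measure lebesgue (ball x r)"
      proof (rule abs_integral_le_measure)
        show "(\<lambda>y. bump1 r x (v i) y * (Q i y - A i (y - x))) integrable_on cbox a b"
          using i by (auto intro!: integrable_continuous continuous_intros Q(1) contA)
        show "\<bar>bump1 r x (v i) y * (Q i y - A i (y - x))\<bar> \<le> 6 * r ^ 5 * norm (v i) * (\<delta> * r) * indicator (ball x r) y" for y
        proof (cases "y \<in> ball x r")
          case True
          then have "norm (y - x) < r" by (simp add: dist_norm norm_minus_commute)
          with Qr[OF i this] \<delta> have "\<bar>Q i y - A i (y - x)\<bar> \<le> \<delta> * r"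
            by (smt (verit) mult_left_mono)
          then show ?thesis
            using True bump1_bound[OF r(1), of x "v i" y] \<delta> r(1)
            by (auto simp: abs_mult intro!: mult_mono)
        qed (use r(1) in \<open>simp add: bump1_eq_0\<close>)
      qed (use r(1) \<delta> in auto)
      have b2: "\<bar>integral (cbox a b) (\<lambda>y. bump1 r x (v i) y * (Q i y + N i y))\<bar> \<le>
          6 * r ^ 5 * norm (v i) * C * measure lebesgue (ball x r - E)"
      proof (rule abs_integral_le_measure)
        show "(\<lambda>y. bump1 r x (v i) y * (Q i y + N i y)) integrable_on cbox a b"
          using i by (auto intro!: integrable_continuous continuous_intros Q(1) N)
        show "ball x r - E \<in> lmeasurable"
          by (rule meas[OF r(1) sub(1)])
        show "\<bar>bump1 r x (v i) y * (Q i y + N i y)\<bar> \<le> 6 * r ^ 5 * norm (v i) * C * indicator (ball x r - E) y"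
          if "y \<in> cbox a b" for y
        proof (cases "y \<in> ball x r - E")
          case True
          have "\<bar>bump1 r x (v i) y * (Q i y + N i y)\<bar> \<le> 6 * r ^ 5 * norm (v i) * C"
            unfolding abs_mult
            using bump1_bound[OF r(1), of x "v i" y] C(2)[OF i that] r(1)
            by (intro mult_mono) auto
          then show ?thesis using True by simp
        next
          case False
          then show ?thesis
            using r(1) E[OF i that] bump1_eq_0[of y x r] by auto
        qed
      qed (use r(1) C(1) in auto)
      from b1 b2 show "\<bar>integral (cbox a b) (\<lambda>y. bump1 r x (v i) y * (Q i y - A i (y - x)))
        - integral (cbox a b) (\<lambda>y. bump1 r x (v i) y * (Q i y + N i y))\<bar>
        \<le> 6 * r ^ 5 * norm (v i) * (\<delta> * r) * measure lebesgue (ball x r)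
        + 6 * r ^ 5 * norm (v i) * C * measure lebesgue (ball x r - E)"
        by linarith
    qed
    also have "\<dots> = 6 * r ^ 5 * S * (\<delta> * r) * measure lebesgue (ball x r)
        + 6 * r ^ 5 * S * C * measure lebesgue (ball x r - E)"
      unfolding S_def by (simp only: sum.distrib sum_distrib_left sum_distrib_right)
    \<comment> \<open>Here the exponent \<open>DIM('a) + 1\<close> matters: its extra factor
      \<open>r\<close> makes up for the \<open>r ^ 5\<close> of the bump derivative, so both errors
      have the order \<open>r ^ 6 * r ^ DIM('a)\<close> of the mass \<open>c\<close>, times
      \<open>\<delta>\<close>.\<close>
    also have "\<dots> \<le> 6 * r ^ 5 * S * (\<delta> * r) * (V * r ^ DIM('a)) + 6 * r ^ 5 * S * C * (\<delta> * r ^ (DIM('a) + 1))"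
      using V(2)[of r] r S C(1) \<delta> by (intro add_mono mult_left_mono) auto
    also have "\<dots> = (r ^ 6 * r ^ DIM('a)) * (\<delta> * (6 * S * (C + V)))"
      by (simp add: numeral_eq_Suc algebra_simps)
    finally have up: "\<bar>c * D\<bar> \<le> (r ^ 6 * r ^ DIM('a)) * (\<delta> * (6 * S * (C + V)))" .
    have "27 / 64 * r ^ 6 * (V * (r / 2) ^ DIM('a)) \<le> c"
      using integral_bump_lower_bound[OF r(1), of x] integral_bump_cbox[OF r(1) sub(2)] V(2)[of "r / 2"] r(1)
      by (simp add: c_def)
    then have "(r ^ 6 * r ^ DIM('a)) * (27 / 64 * V / 2 ^ DIM('a)) \<le> c"
      by (simp add: power_divide ac_simps)
    then have "(r ^ 6 * r ^ DIM('a)) * (27 / 64 * V / 2 ^ DIM('a)) * \<bar>D\<bar> \<le> \<bar>c * D\<bar>"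
      unfolding abs_mult by (intro mult_right_mono) auto
    with up have "(r ^ 6 * r ^ DIM('a)) * (\<bar>D\<bar> * (27 / 64 * V / 2 ^ DIM('a))) \<le>
        (r ^ 6 * r ^ DIM('a)) * (\<delta> * (6 * S * (C + V)))"
      by (simp only: ac_simps)
    then show ?thesis
      using r(1) by (simp only: mult_le_cancel_left_pos mult_pos_pos zero_less_power)
  qed
  \<comment> \<open>Letting \<open>\<delta>\<close> tend to zero forces \<open>D\<close> to
    vanish.\<close>
  have "((\<lambda>\<delta>. \<delta> * (6 * S * (C + V))) \<longlongrightarrow> 0 * (6 * S * (C + V))) (at_right 0)"
    by (intro tendsto_intros)
  moreover have "\<forall>\<^sub>F \<delta> in at_right 0. \<bar>D\<bar> * (27 / 64 * V / 2 ^ DIM('a)) \<le> \<delta> * (6 * S * (C + V))"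
    using eventually_at_right_less[of 0] by eventually_elim (rule key)
  ultimately have "\<bar>D\<bar> * (27 / 64 * V / 2 ^ DIM('a)) \<le> 0"
    using tendsto_lowerbound[of _ _ "at_right (0::real)"] by fastforce
  moreover have "0 < 27 / 64 * V / 2 ^ DIM('a)"
    using V(1)[of 0] by simp
  ultimately have "\<bar>D\<bar> \<le> 0"
    by (metis mult_le_cancel_right_pos mult_zero_left)
  then have "D = 0"
    by simp
  then show ?thesis by (simp add: D_def)
qed

section \<open>Forms of class \<open>C\<^sup>1\<close>\<close>

lemma C1_on_has_derivative:
  assumes "C1_on S g" "y \<in> S"
  shows "(g has_derivative frechet_derivative g (at y)) (at y)"
  using assms unfolding C1_on_def frechet_derivative_works[symmetric] by (blast intro: differentiableI)

lemma C1_on_continuous_derivative: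
  assumes "C1_on S g"
  shows "continuous_on S (\<lambda>y. frechet_derivative g (at y) u)"
proof -
  obtain g' where g': "\<And>y. y \<in> S \<Longrightarrow> (g has_derivative blinfun_apply (g' y)) (at y)" "continuous_on S g'"
    using assms unfolding C1_on_def by auto
  have "continuous_on S (\<lambda>y. blinfun_apply (g' y) u)"
    by (intro continuous_intros g')
  then show ?thesis
    by (rule continuous_on_cong[THEN iffD1, rotated -1])
      (auto dest: frechet_derivative_at[OF g'(1)])
qed

lemma C1_on_imp_continuous_on: "C1_on S g \<Longrightarrow> continuous_on S g"
  by (intro continuous_at_imp_continuous_on ballI has_derivative_continuous[OF C1_on_has_derivative])

lemma C1_on_subset: "C1_on S g \<Longrightarrow> T \<subseteq> S \<Longrightarrow> C1_on T g"
  unfolding C1_on_def by (meson continuous_on_subset subsetD)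

lemma C1_form_subset: "C1_form h S \<omega> \<Longrightarrow> T \<subseteq> S \<Longrightarrow> C1_form h T \<omega>"
  unfolding C1_form_def by (meson C1_on_subset subsetD)

text \<open>A product rule at a zero of \<open>F\<close>, where continuity of \<open>p\<close> is
  enough: the error splits into \<open>p y\<close> times the remainder of \<open>F\<close> and
  \<open>p y - p x\<close> times the linear part. It is needed because the coefficients
  \<open>p\<close> will contain the derivative of a map of class \<open>C\<^sup>1\<close>.\<close>

lemma has_derivative_mult_vanishing:
  fixes p F :: "'a::real_normed_vector \<Rightarrow> real"
  assumes p: "isCont p x" and F: "(F has_derivative F') (at x)" "F x = 0"
  shows "((\<lambda>y. p y * F y) has_derivative (\<lambda>u. p x * F' u)) (at x)"
  unfolding has_derivative_iff_norm
proof
  have lin: "bounded_linear F'" and lim: "((\<lambda>y. norm (F y - F x - F' (y - x)) / norm (y - x)) \<longlongrightarrow> 0) (at x)"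
    using F(1) unfolding has_derivative_iff_norm by auto
  show "bounded_linear (\<lambda>u. p x * F' u)"
    by (intro bounded_linear_intros lin)
  obtain K where K: "\<And>u. norm (F' u) \<le> norm u * K"
    using bounded_linear.bounded[OF lin] by blast
  have "((\<lambda>y. \<bar>p y\<bar> * (norm (F y - F x - F' (y - x)) / norm (y - x)) + \<bar>p y - p x\<bar> * K)
      \<longlongrightarrow> \<bar>p x\<bar> * 0 + \<bar>p x - p x\<bar> * K) (at x)"
    using p by (intro tendsto_intros lim) (auto simp: isCont_def)
  then have *: "((\<lambda>y. \<bar>p y\<bar> * (norm (F y - F x - F' (y - x)) / norm (y - x)) + \<bar>p y - p x\<bar> * K) \<longlongrightarrow> 0) (at x)"
    by simp
  show "((\<lambda>y. norm (p y * F y - p x * F x - p x * F' (y - x)) / norm (y - x)) \<longlongrightarrow> 0) (at x)"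
  proof (rule Lim_null_comparison[OF _ *])
    show "\<forall>\<^sub>F y in at x. norm (norm (p y * F y - p x * F x - p x * F' (y - x)) / norm (y - x))
        \<le> \<bar>p y\<bar> * (norm (F y - F x - F' (y - x)) / norm (y - x)) + \<bar>p y - p x\<bar> * K"
      unfolding eventually_at_filter
    proof (intro always_eventually allI impI)
      fix y assume "y \<noteq> x"
      have "p y * F y - p x * F x - p x * F' (y - x) = p y * (F y - F x - F' (y - x)) + (p y - p x) * F' (y - x)"
        using F(2) by (simp add: algebra_simps)
      then have "\<bar>p y * F y - p x * F x - p x * F' (y - x)\<bar>
          \<le> \<bar>p y\<bar> * \<bar>F y - F x - F' (y - x)\<bar> + \<bar>p y - p x\<bar> * \<bar>F' (y - x)\<bar>"
        by (metis abs_mult abs_triangle_ineq)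
      also have "\<dots> \<le> \<bar>p y\<bar> * \<bar>F y - F x - F' (y - x)\<bar> + \<bar>p y - p x\<bar> * (norm (y - x) * K)"
        using K[of "y - x"] by (intro add_left_mono mult_left_mono) auto
      finally show "norm (norm (p y * F y - p x * F x - p x * F' (y - x)) / norm (y - x))
        \<le> \<bar>p y\<bar> * (norm (F y - F x - F' (y - x)) / norm (y - x)) + \<bar>p y - p x\<bar> * K"
        using \<open>y \<noteq> x\<close> by (simp add: field_simps)
    qed
  qed
qed

text \<open>Continuity for each fixed tuple of vectors yields joint continuity, since the basis
  expansion involves only finitely many fixed tuples.\<close>

lemma continuous_on_form:
  fixes \<omega> :: "'b::euclidean_space \<Rightarrow> (nat \<Rightarrow> 'b) \<Rightarrow> real"
  assumes \<omega>: "\<And>z. z \<in> S \<Longrightarrow> alt_form h (\<omega> z)" "\<And>v. continuous_on S (\<lambda>z. \<omega> z v)"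
    and g: "continuous_on T g" "g ` T \<subseteq> S" and w: "\<And>k. continuous_on T (\<lambda>y. w y k)"
  shows "continuous_on T (\<lambda>y. \<omega> (g y) (w y))"
proof -
  have "continuous_on T (\<lambda>y. \<Sum>I\<in>PiE {..<h} (\<lambda>_. Basis). (\<Prod>k<h. w y k \<bullet> I k) * \<omega> (g y) I)"
    using g by (intro continuous_intros w continuous_on_compose2[OF \<omega>(2) g(1)])
  then show ?thesis
    by (rule continuous_on_cong[THEN iffD1, rotated -1])
      (use g \<omega>(1) in \<open>auto simp: alt_form_expansion[symmetric] image_subset_iff\<close>)
qed

text \<open>In the basis expansion each coefficient increment vanishes at \<open>x\<close>, so
  \<open>has_derivative_mult_vanishing\<close> applies with the merely continuous coordinates of
  \<open>w\<close> as factors. The derivative therefore sees only the value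
  \<open>w x\<close>.\<close>

lemma has_derivative_form_increment:
  fixes \<omega> :: "'b::euclidean_space \<Rightarrow> (nat \<Rightarrow> 'b) \<Rightarrow> real" and g :: "'a::euclidean_space \<Rightarrow> 'b"
  assumes \<omega>: "\<And>z. z \<in> S \<Longrightarrow> alt_form h (\<omega> z)"
    and D\<omega>: "\<And>v. ((\<lambda>z. \<omega> z v) has_derivative frechet_derivative (\<lambda>z. \<omega> z v) (at (g x))) (at (g x))"
    and S: "open S" "g x \<in> S" and g: "(g has_derivative L) (at x)" and w: "\<And>k. isCont (\<lambda>y. w y k) x"
  shows "((\<lambda>y. \<omega> (g y) (w y) - \<omega> (g x) (w y)) has_derivative
      (\<lambda>u. frechet_derivative (\<lambda>z. \<omega> z (w x)) (at (g x)) (L u))) (at x)"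
proof -
  let ?P = "PiE {..<h} (\<lambda>_. Basis :: 'b set)"
  define d where "d I = frechet_derivative (\<lambda>z. \<omega> z I) (at (g x))" for I
  have "((\<lambda>y. \<omega> (g y) I - \<omega> (g x) I) has_derivative (\<lambda>u. d I (L u))) (at x)" for I
    using has_derivative_diff[OF has_derivative_compose[OF g D\<omega>[of I]] has_derivative_const[of "\<omega> (g x) I"]]
    by (simp add: d_def)
  then have "((\<lambda>y. (\<Prod>k<h. w y k \<bullet> I k) * (\<omega> (g y) I - \<omega> (g x) I)) has_derivative
      (\<lambda>u. (\<Prod>k<h. w x k \<bullet> I k) * d I (L u))) (at x)" for I
    by (intro has_derivative_mult_vanishing) (auto intro!: continuous_intros w)
  then have sum: "((\<lambda>y. \<Sum>I\<in>?P. (\<Prod>k<h. w y k \<bullet> I k) * (\<omega> (g y) I - \<omega> (g x) I)) has_derivative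
      (\<lambda>u. \<Sum>I\<in>?P. (\<Prod>k<h. w x k \<bullet> I k) * d I (L u))) (at x)"
    by (intro has_derivative_sum)
  have "isCont g x"
    using g by (rule has_derivative_continuous)
  then have "\<forall>\<^sub>F y in at x. g y \<in> S"
    using S by (auto simp: isCont_def intro: topological_tendstoD)
  then have ev: "\<forall>\<^sub>F y in at x. (\<Sum>I\<in>?P. (\<Prod>k<h. w y k \<bullet> I k) * (\<omega> (g y) I - \<omega> (g x) I))
      = \<omega> (g y) (w y) - \<omega> (g x) (w y)"
  proof eventually_elim
    case (elim y)
    show ?case
      unfolding alt_form_expansion[OF \<omega>[OF elim], of "w y"] alt_form_expansion[OF \<omega>[OF S(2)], of "w y"]
      by (simp add: right_diff_distrib sum_subtractf)
  qed
  have "((\<lambda>y. \<omega> (g y) (w y) - \<omega> (g x) (w y)) has_derivative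
      (\<lambda>u. \<Sum>I\<in>?P. (\<Prod>k<h. w x k \<bullet> I k) * d I (L u))) (at x)"
    by (rule has_derivative_transform_eventually[OF sum ev]) auto
  \<comment> \<open>The basis expansion of the derivative is folded back into the derivative of the
    form evaluated at the fixed tuple \<open>w x\<close>.\<close>
  moreover have "(\<lambda>u. \<Sum>I\<in>?P. (\<Prod>k<h. w x k \<bullet> I k) * d I u) = frechet_derivative (\<lambda>z. \<omega> z (w x)) (at (g x))"
  proof (rule frechet_derivative_at)
    have "((\<lambda>z. \<Sum>I\<in>?P. (\<Prod>k<h. w x k \<bullet> I k) * \<omega> z I) has_derivative
        (\<lambda>u. \<Sum>I\<in>?P. (\<Prod>k<h. w x k \<bullet> I k) * d I u)) (at (g x))"
      unfolding d_def by (intro has_derivative_sum has_derivative_mult_right D\<omega>)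
    then show "((\<lambda>z. \<omega> z (w x)) has_derivative (\<lambda>u. \<Sum>I\<in>?P. (\<Prod>k<h. w x k \<bullet> I k) * d I u)) (at (g x))"
      by (rule has_derivative_transform_within_open[OF _ S]) (metis \<omega> alt_form_expansion)
  qed
  ultimately show ?thesis
    by (simp add: fun_eq_iff)
qed

section \<open>Pullbacks\<close>

text \<open>The theorem for a map between open subsets of Euclidean spaces, obtained from
  \<open>superdense_sum_derivative_eq_0\<close> with one summand for each omitted vector.\<close>

lemma superdense_pullback_ext_d_eq_0:
  fixes g :: "'a::euclidean_space \<Rightarrow> 'b::euclidean_space"
  assumes U: "open U" "x \<in> U" and S: "open S" "g ` U \<subseteq> S" and g: "C1_on U g"
    and \<omega>: "C1_form (Suc p) S \<omega>" and lam: "C1_form p U lam"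
    and E: "\<And>y. y \<in> U \<Longrightarrow> y \<in> E \<longleftrightarrow> (\<forall>v. ext_d p lam y v = pullback g \<omega> y v)"
    and dense: "x \<in> superdense (DIM('a) + 1) E"
  shows "pullback g (ext_d (Suc p) \<omega>) x v = 0"
proof -
  obtain a b where ab: "cbox a b \<subseteq> U" "x \<in> box a b" "\<forall>i\<in>Basis. a \<bullet> i < b \<bullet> i"
    by (rule open_contains_cbox[OF U])
  define Dg where "Dg y = frechet_derivative g (at y)" for y
  have Dg: "(g has_derivative Dg y) (at y)" if "y \<in> U" for y
    unfolding Dg_def by (rule C1_on_has_derivative[OF g that])
  have contDg: "continuous_on U (\<lambda>y. Dg y u)" for u
    unfolding Dg_def by (rule C1_on_continuous_derivative[OF g])
  have contg: "continuous_on U g"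
    by (rule C1_on_imp_continuous_on[OF g])
  have alt: "alt_form (Suc p) (\<omega> z)" if "z \<in> S" for z
    using \<omega> that by (auto simp: C1_form_def)
  have \<omega>C1: "C1_on S (\<lambda>z. \<omega> z u)" for u
    using \<omega> by (auto simp: C1_form_def)
  have gx: "g x \<in> S" using U S by auto
  have lamC1: "C1_on U (\<lambda>y. lam y u)" for u
    using lam by (auto simp: C1_form_def)
  have cont_pullback: "continuous_on U (\<lambda>y. pullback g \<omega> y u)" for u
    unfolding pullback_def Dg_def[symmetric]
    by (rule continuous_on_form[where S = S and h = "Suc p"])
      (use alt contg S(2) contDg C1_on_imp_continuous_on[OF \<omega>C1] in auto)
  have cont_dlam: "continuous_on U (\<lambda>y. ext_d p lam y u)" for u
    unfolding ext_d_def by (intro continuous_intros C1_on_continuous_derivative[OF lamC1])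
  have cont_const: "continuous_on U (\<lambda>y. \<omega> (g x) (\<lambda>k. Dg y (u k)))" for u
    by (intro continuous_on_alt_form[OF alt[OF gx]] contDg)
  \<comment> \<open>\<open>Q\<close> is the increment of the form relative to its value frozen at
    \<open>g x\<close>, while \<open>N\<close> collects the weakly closed terms. Up to sign,
    \<open>Q i + N i\<close> is the difference of the pullback and d lam, which vanishes on
    \<open>E\<close>.\<close>
  define Q where "Q i y = (-1) ^ i * (pullback g \<omega> y (skip i v) - \<omega> (g x) (\<lambda>k. Dg y (skip i v k)))" for i y
  define N where "N i y = (-1) ^ i * (\<omega> (g x) (\<lambda>k. Dg y (skip i v k)) - ext_d p lam y (skip i v))" for i y
  define A where "A i u = (-1) ^ i *
    frechet_derivative (\<lambda>z. \<omega> z (\<lambda>k. Dg x (skip i v k))) (at (g x)) (Dg x u)" for i u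
  have "(\<Sum>i\<le>Suc p. A i (v i)) = 0"
  proof (rule superdense_sum_derivative_eq_0[OF _ ab(2) _ _ _ _ _ _ _ dense, where Q = Q and N = N])
    fix i
    show "continuous_on (cbox a b) (Q i)" "continuous_on (cbox a b) (N i)"
      unfolding Q_def N_def
      by (intro continuous_intros continuous_on_subset[OF cont_pullback ab(1)]
          continuous_on_subset[OF cont_dlam ab(1)] continuous_on_subset[OF cont_const ab(1)])+
    show "Q i x = 0"
      by (simp add: Q_def pullback_def Dg_def)
    have "((\<lambda>y. \<omega> (g y) (\<lambda>k. Dg y (skip i v k)) - \<omega> (g x) (\<lambda>k. Dg y (skip i v k))) has_derivative
        (\<lambda>u. frechet_derivative (\<lambda>z. \<omega> z (\<lambda>k. Dg x (skip i v k))) (at (g x)) (Dg x u))) (at x)"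
    proof (rule has_derivative_form_increment[OF alt C1_on_has_derivative[OF \<omega>C1 gx] S(1) gx Dg[OF U(2)]])
      show "isCont (\<lambda>y. Dg y (skip i v k)) x" for k
        using contDg U by (auto simp: continuous_on_eq_continuous_at)
    qed
    then show "(Q i has_derivative A i) (at x)"
      unfolding Q_def A_def pullback_def Dg_def[symmetric] by (intro has_derivative_mult_right)
  next
    fix r :: real assume r: "r > 0" "cball x r \<subseteq> box a b"
    have r': "cball x r \<subseteq> cbox a b" using r(2) box_subset_cbox[of a b] by blast
    have int: "(\<lambda>y. bump1 r x (v i) y * \<omega> (g x) (\<lambda>k. Dg y (skip i v k))) integrable_on cbox a b"
      "(\<lambda>y. bump1 r x (v i) y * ext_d p lam y (skip i v)) integrable_on cbox a b" for i
      by (intro integrable_continuous continuous_intros continuous_on_subset[OF cont_dlam ab(1)]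
          continuous_on_subset[OF cont_const ab(1)])+
    have "integral (cbox a b) (\<lambda>y. bump1 r x (v i) y * N i y) =
        (-1) ^ i * integral (cbox a b) (\<lambda>y. bump1 r x (v i) y * \<omega> (g x) (\<lambda>k. Dg y (skip i v k)))
        - (-1) ^ i * integral (cbox a b) (\<lambda>y. bump1 r x (v i) y * ext_d p lam y (skip i v))" for i
    proof -
      have eq: "(\<lambda>y. bump1 r x (v i) y * N i y) = (\<lambda>y. (-1) ^ i * (bump1 r x (v i) y * \<omega> (g x) (\<lambda>k. Dg y (skip i v k))
          - bump1 r x (v i) y * ext_d p lam y (skip i v)))"
        by (simp add: N_def algebra_simps)
      show ?thesis
        unfolding eq integral_mult_right integral_diff[OF int] by (rule right_diff_distrib)
    qed
    then have "(\<Sum>i\<le>Suc p. integral (cbox a b) (\<lambda>y. bump1 r x (v i) y * N i y)) =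
        (\<Sum>i\<le>Suc p. (-1) ^ i * integral (cbox a b) (\<lambda>y. bump1 r x (v i) y * \<omega> (g x) (\<lambda>k. Dg y (skip i v k))))
        - (\<Sum>i\<le>Suc p. (-1) ^ i * integral (cbox a b) (\<lambda>y. bump1 r x (v i) y * ext_d p lam y (skip i v)))"
      by (simp only: sum_subtractf)
    also have "\<dots> = 0"
      using integral_bump1_pullback_const_eq_0[OF alt[OF gx] U(1) ab(1) r Dg contDg, of v]
        integral_bump1_ext_d_eq_0[OF U(1) ab(1) r(1) r' C1_on_has_derivative[OF lamC1]
          C1_on_continuous_derivative[OF lamC1], where p = p and v = v]
      by simp
    finally show "(\<Sum>i\<le>Suc p. integral (cbox a b) (\<lambda>y. bump1 r x (v i) y * N i y)) = 0" .
    \<comment> \<open>Measurability of the bad set: it is a union, over all tuples \<open>u\<close>,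
      of open sets on which a continuous function is nonzero. The union is uncountable, but openness
      survives it.\<close>
    have "open {y \<in> U. ext_d p lam y u - pullback g \<omega> y u \<noteq> 0}" for u
    proof -
      have "open (U \<inter> (\<lambda>y. ext_d p lam y u - pullback g \<omega> y u) -` (- {0}))"
        by (intro continuous_open_preimage continuous_intros cont_dlam cont_pullback U(1))
      moreover have "U \<inter> (\<lambda>y. ext_d p lam y u - pullback g \<omega> y u) -` (- {0}) =
          {y \<in> U. ext_d p lam y u - pullback g \<omega> y u \<noteq> 0}"
        by auto
      ultimately show ?thesis by simp
    qed
    then have "open (ball x r \<inter> (\<Union>u. {y \<in> U. ext_d p lam y u - pullback g \<omega> y u \<noteq> 0}))"
      by (intro open_Int open_ball open_UN) auto
    moreover have "ball x r \<subseteq> U"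
      using r' ab(1) ball_subset_cball[of x r] by blast
    then have "ball x r - E = ball x r \<inter> (\<Union>u. {y \<in> U. ext_d p lam y u - pullback g \<omega> y u \<noteq> 0})"
      using E by auto
    ultimately have "open (ball x r - E)"
      by simp
    then show "ball x r - E \<in> lmeasurable"
      by (intro lmeasurable_open) (auto intro: bounded_subset[OF bounded_ball])
  next
    fix i y assume "y \<in> cbox a b" "y \<in> E"
    then have "ext_d p lam y (skip i v) = pullback g \<omega> y (skip i v)"
      using E[of y] ab(1) by auto
    then show "Q i y + N i y = 0"
      by (simp add: Q_def N_def algebra_simps)
  qed auto
  \<comment> \<open>The sum of the \<open>A i (v i)\<close> is literally the formula for the
    exterior derivative at \<open>g x\<close>, applied to the image vectors.\<close>
  then show ?thesis
    by (simp only: A_def pullback_def ext_d_def Dg_def[symmetric] skip_comp)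
qed

section \<open>Passage to charts of the manifold\<close>

lemma open_chart_preimage:
  fixes U :: "'m::euclidean_space set"
  assumes "C2_atlas X A" "(W, \<phi>) \<in> A" "open U" "C1_map_to U X A f"
  shows "open (U \<inter> f -` W)"
proof -
  have "openin X W"
    using assms(1,2) unfolding C2_atlas_def by auto
  moreover have "continuous_map (top_of_set U) X f"
    using assms(4) by (simp add: C1_map_to_def)
  ultimately have "openin (top_of_set U) {y \<in> U. f y \<in> W}"
    using openin_continuous_map_preimage by fastforce
  then have "open {y \<in> U. f y \<in> W}"
    using assms(3) by (simp add: openin_open_eq)
  moreover have "{y \<in> U. f y \<in> W} = U \<inter> f -` W"
    by auto
  ultimately show ?thesis by simp
qed

text \<open>Independence of the chart picked by \<open>SOME\<close> in \<open>mpullback\<close>: the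
  chain rule for the transition map matches the compatibility condition in
  \<open>C1_mform\<close>.\<close>

lemma mpullback_eq_pullback_chart:
  fixes U :: "'m::euclidean_space set" and A :: "('a set \<times> ('a \<Rightarrow> real^'n)) set"
  assumes atlas: "C2_atlas X A" and c: "(W, \<phi>) \<in> A" and U: "open U" and f: "C1_map_to U X A f"
    and \<omega>: "C1_mform X A h \<omega>" and y: "y \<in> U" "f y \<in> W"
  shows "mpullback A f \<omega> y v = pullback (\<phi> \<circ> f) (\<omega> (W, \<phi>)) y v"
proof -
  define c' where "c' = (SOME c. c \<in> A \<and> f y \<in> fst c)"
  obtain W' \<psi> where c'_eq: "c' = (W', \<psi>)" by fastforce
  have "c' \<in> A \<and> f y \<in> fst c'"
    unfolding c'_def by (rule someI[of _ "(W, \<phi>)"]) (use c y in auto)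
  then have c': "(W', \<psi>) \<in> A" "f y \<in> W'"
    by (auto simp: c'_eq)
  let ?T = "\<psi> \<circ> inv_into W \<phi>" and ?z = "\<phi> (f y)"
  have inj: "inj_on \<phi> W"
  proof -
    have "openin X W" "homeomorphic_map (subtopology X W) (top_of_set (\<phi> ` W)) \<phi>"
      using atlas c unfolding C2_atlas_def by auto
    then show ?thesis
      using homeomorphic_imp_injective_map[of "subtopology X W"] openin_subset[of X W]
      by (metis topspace_subtopology_subset)
  qed
  have z: "?z \<in> \<phi> ` (W \<inter> W')" using y c' by auto
  have "C2_on (\<phi> ` (W \<inter> W')) ?T"
    using atlas c c' unfolding C2_atlas_def by fast
  then obtain T' where T: "(?T has_derivative T') (at ?z)"
    using z unfolding C2_on_def by blast
  have "C1_on (U \<inter> f -` W) (\<phi> \<circ> f)"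
    using f c unfolding C1_map_to_def by auto
  then have \<phi>f: "((\<phi> \<circ> f) has_derivative frechet_derivative (\<phi> \<circ> f) (at y)) (at y)"
    by (rule C1_on_has_derivative) (use y in auto)
  have "((?T \<circ> (\<phi> \<circ> f)) has_derivative T' \<circ> frechet_derivative (\<phi> \<circ> f) (at y)) (at y)"
    using diff_chain_at[OF \<phi>f, of ?T T'] T by simp
  \<comment> \<open>The transition map composed with \<open>\<phi> \<circ> f\<close> agrees with
    \<open>\<psi> \<circ> f\<close> only where \<open>f\<close> lands in \<open>W\<close>, an open
    condition by \<open>open_chart_preimage\<close>.\<close>
  then have "((\<psi> \<circ> f) has_derivative T' \<circ> frechet_derivative (\<phi> \<circ> f) (at y)) (at y)"
    by (rule has_derivative_transform_within_open[OF _ open_chart_preimage[OF atlas c U f]])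
      (use y inj in auto)
  then have \<psi>f: "frechet_derivative (\<psi> \<circ> f) (at y) = T' \<circ> frechet_derivative (\<phi> \<circ> f) (at y)"
    by (rule frechet_derivative_at[symmetric])
  have "\<omega> (W, \<phi>) ?z u = pullback ?T (\<omega> (W', \<psi>)) ?z u" for u
    using \<omega> c c' z unfolding C1_mform_def by fast
  then have "pullback (\<phi> \<circ> f) (\<omega> (W, \<phi>)) y v = pullback (\<psi> \<circ> f) (\<omega> (W', \<psi>)) y v"
    using inj y by (simp add: pullback_def \<psi>f frechet_derivative_at[OF T, symmetric])
  then show ?thesis
    by (simp add: mpullback_def c'_def[symmetric] c'_eq Let_def)
qed

theorem theorem4p1:
  fixes X :: "'a topology"
    and A :: "('a set \<times> ('a \<Rightarrow> real^'n)) set"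
    and \<omega> :: "('a, 'n) mform"
    and U :: "(real^'m) set"
    and f :: "real^'m \<Rightarrow> 'a"
    and lam :: "real^'m \<Rightarrow> (nat \<Rightarrow> real^'m) \<Rightarrow> real"
    and h :: nat
  assumes "C2_manifold X A"
    and "h \<ge> 1"
    and "C1_mform X A h \<omega>"
    and "open U"
    and "C1_map_to U X A f"
    and "C1_form (h - 1) U lam"
  shows "U \<inter> superdense (CARD('m) + 1)
             {x \<in> U. \<forall>v. ext_d (h - 1) lam x v = mpullback A f \<omega> x v}
         \<subseteq> {x \<in> U. \<forall>v. mpullback A f (mext_d h \<omega>) x v = 0}"
proof
  define E where "E = {x \<in> U. \<forall>v. ext_d (h - 1) lam x v = mpullback A f \<omega> x v}"
  fix x assume "x \<in> U \<inter> superdense (CARD('m) + 1) {x \<in> U. \<forall>v. ext_d (h - 1) lam x v = mpullback A f \<omega> x v}"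
  then have x: "x \<in> U" "x \<in> superdense (DIM(real^'m) + 1) E"
    by (auto simp: E_def)
  have atlas: "C2_atlas X A"
    using assms(1) by (simp add: C2_manifold_def)
  obtain p where p: "h = Suc p"
    using assms(2) by (cases h) auto
  \<comment> \<open>The very chart that \<open>mpullback\<close> selects at \<open>x\<close>. The
    conclusion then unfolds directly in this chart, without a compatibility statement for
    \<open>mext_d h \<omega>\<close>.\<close>
  define c where "c = (SOME c. c \<in> A \<and> f x \<in> fst c)"
  obtain W \<phi> where c_eq: "c = (W, \<phi>)" by fastforce
  have "f x \<in> topspace X"
    using assms(5) x(1) by (auto simp: C1_map_to_def continuous_map_def Pi_iff)
  moreover have "(\<Union>(W, \<phi>)\<in>A. W) = topspace X"
    using atlas by (simp add: C2_atlas_def)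
  ultimately have "\<exists>c. c \<in> A \<and> f x \<in> fst c"
    by fastforce
  then have "c \<in> A \<and> f x \<in> fst c"
    unfolding c_def by (rule someI_ex)
  then have c: "(W, \<phi>) \<in> A" "f x \<in> W"
    by (auto simp: c_eq)
  let ?U = "U \<inter> f -` W"
  have "pullback (\<phi> \<circ> f) (ext_d (Suc p) (\<omega> (W, \<phi>))) x v = 0" for v
  proof (rule superdense_pullback_ext_d_eq_0[where U = ?U and S = "\<phi> ` W" and lam = lam and E = E])
    show "open ?U"
      by (rule open_chart_preimage[OF atlas c(1) assms(4,5)])
    show "open (\<phi> ` W)"
      using atlas c(1) unfolding C2_atlas_def by auto
    show "C1_on ?U (\<phi> \<circ> f)"
      using assms(5) c(1) unfolding C1_map_to_def by auto
    show "C1_form (Suc p) (\<phi> ` W) (\<omega> (W, \<phi>))"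
      using assms(3) c(1) p unfolding C1_mform_def by fastforce
    show "C1_form p ?U lam"
      using assms(6) p by (auto intro: C1_form_subset)
    \<comment> \<open>At points other than \<open>x\<close>, \<open>mpullback\<close> may select
      other charts; chart independence describes \<open>E\<close> near \<open>x\<close> in the
      single chart \<open>c\<close>.\<close>
    show "y \<in> E \<longleftrightarrow> (\<forall>v. ext_d p lam y v = pullback (\<phi> \<circ> f) (\<omega> (W, \<phi>)) y v)" if "y \<in> ?U" for y
      using that p mpullback_eq_pullback_chart[OF atlas c(1) assms(4,5,3), of y]
      by (simp add: E_def)
    show "x \<in> superdense (DIM(real^'m) + 1) E"
      by (rule x(2))
  qed (use x c in auto)
  then have "mpullback A f (mext_d h \<omega>) x v = 0" for v
    by (simp add: mpullback_def c_def[symmetric] c_eq Let_def mext_d_def p)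
  then show "x \<in> {x \<in> U. \<forall>v. mpullback A f (mext_d h \<omega>) x v = 0}"
    using x(1) by simp
qed

end
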